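(* Let $G=(V,E)$ be a graph with $n=|V|$, $m=|E|$, and fix integers $c\ge 1$, $0\le k\le n$ and $\ell>k$. Let ${\bf s}_G$ be the string associated to $G,c,\ell$ as described in the context. Then $G$ has a vertex cover of size $k$ if and only if there is a $c$-BLZ parsing of ${\bf s}_G$ of size $4n+6m+k+\ell(c-1)$.
   Context: Strings: for ${\bf s}=s_1\dots s_N$ and $1\le i\le j\le N$, ${\bf s}[i,j]=s_i\dots s_j$. A parsing of ${\bf s}$ is a partition of ${\bf s}$ into consecutive nonempty substrings called phrases; its size is the number of phrases. An LZ-parsing is a parsing in which every phrase ${\bf s}[a,e]$ either has length $1$, or is given together with a chosen source start $b$ with $1\le b\le a-1$ and ${\bf s}[b,b+(e-a)-1]={\bf s}[a,e-1]$ (the source may overlap the phrase). For such a phrase, each position $a+t$ with $0\le t\le e-a-1$ has source position $b+(t \bmod (a-b))$. The hop-number of a position $p$ is $hop(p)=0$ if $p$ is the last position of a phrase, and $hop(p)=hop(q)+1$ where $q<p$ is the source position of $p$ otherwise. A $c$-BLZ parsing is an LZ-parsing in which every position has hop-number at most $c$. Construction: $G$ is a simple undirected graph with $V=\{v_1,\dots,v_n\}$, $E=\{e_1,\dots,e_m\}$; for each edge $e_i$ fix an ordering $(v_p,v_q)$ of its endpoints. Use pairwise distinct symbols $v_i,v_i',\#^v_i$ ($i\in[n]$), $e_i,\$_i,\#^e_i$ ($i\in[m]$), $\#^p_t$ ($t\in[n+m]$), and $\#^{(i)}_\gamma$ ($1\le i\le c-1$, $1\le\gamma\le\ell$). Define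 $P=v_1\#^p_1\cdots v_n\#^p_n e_1\#^p_{n+1}\cdots e_m\#^p_{n+m}$; $X_i=v_i'\,v_i\,\#^v_i$, $X=X_1\cdots X_n$; for $e_i=(v_p,v_q)$, $Y_i=v_p'\,v_p\,e_i\,\$_i\,v_q'\,v_q\,e_i\,\$_i\,\#^e_i$, $Y=Y_1\cdots Y_m$; ${\bf s}^{(1)}=PXY$. Set $\alpha^{(1)}={\bf s}^{(1)}$, and for $i\ge1$: $\beta^{(i)}=\alpha^{(i)}\#^{(i)}_1\,\alpha^{(i)}\#^{(i)}_2\cdots\alpha^{(i)}\#^{(i)}_\ell$ and $\alpha^{(i+1)}=\alpha^{(i)}\beta^{(i)}$. Finally ${\bf s}_G=\alpha^{(c)}=\alpha^{(1)}\beta^{(1)}\beta^{(2)}\cdots\beta^{(c-1)}$. A vertex cover of $G$ is a set $C\subseteq V$ meeting every edge. *)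

theory Defs
  imports Main
begin

definition simple_graph :: "'v set \<Rightarrow> 'v set set \<Rightarrow> bool" where
  "simple_graph V E \<longleftrightarrow> finite V \<and> (\<forall>e\<in>E. e \<subseteq> V \<and> card e = 2)"

definition vertex_cover :: "'v set \<Rightarrow> 'v set set \<Rightarrow> 'v set \<Rightarrow> bool" where
  "vertex_cover V E C \<longleftrightarrow> C \<subseteq> V \<and> (\<forall>e\<in>E. C \<inter> e \<noteq> {})"

text \<open>
  The list \<open>vs\<close> is \<open>v\<^sub>1, \<dots>, v\<^sub>n\<close> and \<open>es\<close> is \<open>e\<^sub>1, \<dots>, e\<^sub>m\<close>, where the entry \<open>(p, q)\<close>
  of \<open>es\<close> is the edge \<open>{p, q}\<close> with the chosen ordering of its endpoints.
\<close>
definition graph_enum :: "'v set \<Rightarrow> 'v set set \<Rightarrow> 'v list \<Rightarrow> ('v \<times> 'v) list \<Rightarrow> bool" where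
  "graph_enum V E vs es \<longleftrightarrow>
     distinct vs \<and> set vs = V \<and>
     distinct (map (\<lambda>(p, q). {p, q}) es) \<and> set (map (\<lambda>(p, q). {p, q}) es) = E"

text \<open>
  Positions and phrase numbers are counted from 0. A parsing is the list of its phrases;
  the source (start) of the phrase number \<open>j\<close> is \<open>src j\<close>, which is irrelevant
  for phrases of length 1.
\<close>

definition parsing :: "'a list \<Rightarrow> 'a list list \<Rightarrow> bool" where
  "parsing s ps \<longleftrightarrow> concat ps = s \<and> (\<forall>w\<in>set ps. w \<noteq> [])"

definition phrase_start :: "'a list list \<Rightarrow> nat \<Rightarrow> nat" where
  "phrase_start ps j = length (concat (take j ps))"

text \<open>
  For a phrase \<open>s[a, e]\<close>, \<open>butlast (ps ! j)\<close> is \<open>s[a, e - 1]\<close>, and the right-hand side of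
  the equation is the substring of \<open>s\<close> of length \<open>e - a\<close> that starts at the source.
\<close>
definition lz_parsing :: "'a list \<Rightarrow> 'a list list \<Rightarrow> (nat \<Rightarrow> nat) \<Rightarrow> bool" where
  "lz_parsing s ps src \<longleftrightarrow> parsing s ps \<and>
     (\<forall>j<length ps. length (ps ! j) = 1 \<or>
        src j < phrase_start ps j \<and>
        butlast (ps ! j) = take (length (ps ! j) - 1) (drop (src j) s))"

definition phrase_index :: "'a list list \<Rightarrow> nat \<Rightarrow> nat" where
  "phrase_index ps p = (LEAST j. p < phrase_start ps (Suc j))"

definition source_pos :: "'a list list \<Rightarrow> (nat \<Rightarrow> nat) \<Rightarrow> nat \<Rightarrow> nat" where
  "source_pos ps src p =
     (let j = phrase_index ps p; a = phrase_start ps j; b = src j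
      in b + (p - a) mod (a - b))"

definition last_of_phrase :: "'a list list \<Rightarrow> nat \<Rightarrow> bool" where
  "last_of_phrase ps p \<longleftrightarrow> (\<exists>j<length ps. Suc p = phrase_start ps (Suc j))"

text \<open>
  The value for \<open>source_pos ps src p \<ge> p\<close> only serves to make the function total: this case
  does not occur in an LZ-parsing, see lemma \<open>hop_copy\<close> below.
\<close>
function hop :: "'a list list \<Rightarrow> (nat \<Rightarrow> nat) \<Rightarrow> nat \<Rightarrow> nat" where
  "hop ps src p =
     (if last_of_phrase ps p then 0
      else if source_pos ps src p < p then hop ps src (source_pos ps src p) + 1
      else 0)"
  by pat_completeness auto
termination
  by (relation "measure (\<lambda>(ps, src, p). p)") auto

declare hop.simps [simp del]

definition blz_parsing :: "nat \<Rightarrow> 'a list \<Rightarrow> 'a list list \<Rightarrow> (nat \<Rightarrow> nat) \<Rightarrow> bool" where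
  "blz_parsing c s ps src \<longleftrightarrow> lz_parsing s ps src \<and> (\<forall>p<length s. hop ps src p \<le> c)"

lemma phrase_start_Suc:
  "j < length ps \<Longrightarrow> phrase_start ps (Suc j) = phrase_start ps j + length (ps ! j)"
  by (simp add: phrase_start_def take_Suc_conv_app_nth)

lemma phrase_index_bounds:
  assumes "p < length (concat ps)"
  defines "j \<equiv> phrase_index ps p"
  shows "j < length ps" "phrase_start ps j \<le> p" "p < phrase_start ps (Suc j)"
proof -
  have ne: "ps \<noteq> []"
    using assms(1) by auto
  then have w: "p < phrase_start ps (Suc (length ps - 1))"
    using assms(1) by (simp add: phrase_start_def)
  show "p < phrase_start ps (Suc j)"
    unfolding j_def phrase_index_def using w by (rule LeastI)
  have "j \<le> length ps - 1"
    unfolding j_def phrase_index_def using w by (rule Least_le)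
  then show "j < length ps"
    using ne by (cases ps) auto
  show "phrase_start ps j \<le> p"
  proof (cases j)
    case 0
    then show ?thesis by (simp add: phrase_start_def)
  next
    case (Suc i)
    then have "\<not> p < phrase_start ps (Suc i)"
      using not_less_Least[of i "\<lambda>j. p < phrase_start ps (Suc j)"]
      by (simp add: j_def phrase_index_def)
    then show ?thesis using Suc by simp
  qed
qed

lemma source_pos_less:
  assumes lz: "lz_parsing s ps src" and p: "p < length s" and nl: "\<not> last_of_phrase ps p"
  shows "source_pos ps src p < p"
proof -
  define j where "j = phrase_index ps p"
  have s: "concat ps = s"
    using lz by (simp add: lz_parsing_def parsing_def)
  note b = phrase_index_bounds[of p ps, unfolded s, OF p, folded j_def]
  have "Suc p \<noteq> phrase_start ps (Suc j)"
    using nl b(1) by (auto simp: last_of_phrase_def)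
  then have "length (ps ! j) \<noteq> 1"
    using b phrase_start_Suc[OF b(1)] by auto
  then have "src j < phrase_start ps j"
    using lz b(1) by (auto simp: lz_parsing_def)
  then have "(p - phrase_start ps j) mod (phrase_start ps j - src j) < phrase_start ps j - src j"
    by simp
  then have "src j + (p - phrase_start ps j) mod (phrase_start ps j - src j) < p"
    using b(2) by linarith
  then show ?thesis
    by (simp add: source_pos_def Let_def flip: j_def)
qed

lemma hop_last: "last_of_phrase ps p \<Longrightarrow> hop ps src p = 0"
  by (simp add: hop.simps)

lemma hop_copy:
  assumes "lz_parsing s ps src" "p < length s" "\<not> last_of_phrase ps p"
  shows "hop ps src p = hop ps src (source_pos ps src p) + 1"
  using source_pos_less[OF assms] assms(3) by (subst hop.simps) simp

text \<open>
  The symbols \<open>v\<^sub>i\<close>, \<open>v\<^sub>i'\<close>, \<open>#\<^sup>v\<^sub>i\<close> and \<open>e\<^sub>i\<close>, \<open>$\<^sub>i\<close>, \<open>#\<^sup>e\<^sub>i\<close> are indexed by the vertex and by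
  the ordered edge instead of by their number.
  \<open>HashP t\<close> is \<open>#\<^sup>p\<^sub>t\<close>, and \<open>HashL i g\<close> is the separator number \<open>g\<close> of level \<open>i\<close>.
\<close>
datatype 'v symb =
    Vert 'v | Vert' 'v | HashV 'v
  | Edge "'v \<times> 'v" | Dollar "'v \<times> 'v" | HashE "'v \<times> 'v"
  | HashP nat
  | HashL nat nat

definition P_str :: "'v list \<Rightarrow> ('v \<times> 'v) list \<Rightarrow> 'v symb list" where
  "P_str vs es =
     concat (map2 (\<lambda>x t. [x, HashP t])
       (map Vert vs @ map Edge es) [1..<Suc (length vs + length es)])"

definition X_str :: "'v list \<Rightarrow> 'v symb list" where
  "X_str vs = concat (map (\<lambda>v. [Vert' v, Vert v, HashV v]) vs)"

definition Y_str :: "('v \<times> 'v) list \<Rightarrow> 'v symb list" where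
  "Y_str es = concat (map (\<lambda>(p, q).
     [Vert' p, Vert p, Edge (p, q), Dollar (p, q),
      Vert' q, Vert q, Edge (p, q), Dollar (p, q), HashE (p, q)]) es)"

definition beta :: "nat \<Rightarrow> nat \<Rightarrow> 'v symb list \<Rightarrow> 'v symb list" where
  "beta l i w = concat (map (\<lambda>g. w @ [HashL i g]) [1..<Suc l])"

text \<open>\<open>alpha s1 l i\<close> is meant for \<open>i \<ge> 1\<close>; the value at 0 is a dummy.\<close>
fun alpha :: "'v symb list \<Rightarrow> nat \<Rightarrow> nat \<Rightarrow> 'v symb list" where
  "alpha s1 l 0 = []"
| "alpha s1 l (Suc 0) = s1"
| "alpha s1 l (Suc (Suc i)) =
     alpha s1 l (Suc i) @ beta l (Suc i) (alpha s1 l (Suc i))"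

definition graph_string :: "'v list \<Rightarrow> ('v \<times> 'v) list \<Rightarrow> nat \<Rightarrow> nat \<Rightarrow> 'v symb list" where
  "graph_string vs es c l = alpha (P_str vs es @ X_str vs @ Y_str es) l c"

end

theory Submission
  imports Defs
begin

text \<open>
  A vertex cover pays one extra phrase per covering vertex, to give the copy of \<open>v\<close> in its block
  \<open>v' v #\<^sup>v\<close> hop-number 0; then every edge gadget can be parsed into four phrases with hop-numbers at
  most 1, and each \<open>\<alpha>\<^sup>(\<^sup>i\<^sup>)\<close> inside \<open>\<beta>\<^sup>(\<^sup>i\<^sup>)\<close> is a single phrase that adds 1 to the hop-numbers.

  Conversely, in every parsing a phrase ends at the first occurrence of each symbol, and inside the first
  occurrence of each pair \<open>v e\<close> with \<open>v \<in> e\<close>. These are all but \<open>k\<close> of the phrase ends. Charge each of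
  the \<open>k\<close> extra ends, in whatever copy of \<open>s\<^sup>(\<^sup>1\<^sup>)\<close> it lies, to a vertex that its neighbouring symbols
  determine. If no end of an edge is charged, then every occurrence of \<open>s\<^sup>(\<^sup>1\<^sup>)\<close> has a hop-number of
  at least 2 at one of two fixed adjacent places of the gadget of that edge. On each level, fewer than
  \<open>\<ell>\<close> extra ends leave some \<open>\<gamma>\<close> such that \<open>\<alpha>\<^sup>(\<^sup>i\<^sup>)\<close> in front of the \<open>\<gamma>\<close>-th separator is never broken up, so the bound increases
  by 1 per level and exceeds \<open>c\<close> on level \<open>c\<close>.
\<close>

section \<open>Phrases and hop-numbers\<close>

lemma phrase_start_mono: "i \<le> j \<Longrightarrow> phrase_start ps i \<le> phrase_start ps j"
proof -
  assume "i \<le> j"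
  then have "take j ps = take i ps @ drop i (take j ps)"
    by (metis append_take_drop_id min.absorb1 take_take)
  then show ?thesis
    unfolding phrase_start_def by (metis concat_append length_append le_add1)
qed

lemma phrase_start_strict:
  assumes "parsing s ps" "i < j" "j \<le> length ps"
  shows "phrase_start ps i < phrase_start ps j"
proof -
  have "ps ! i \<in> set ps" using assms by simp
  then have "ps ! i \<noteq> []" using assms(1) by (auto simp: parsing_def)
  then have "phrase_start ps i < phrase_start ps (Suc i)"
    using assms by (simp add: phrase_start_Suc)
  also have "\<dots> \<le> phrase_start ps j"
    using assms by (intro phrase_start_mono) simp
  finally show ?thesis .
qed

lemma phrase_index_eq:
  assumes "phrase_start ps j \<le> p" "p < phrase_start ps (Suc j)"
  shows "phrase_index ps p = j"
  unfolding phrase_index_def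
proof (rule Least_equality)
  show "j \<le> i" if "p < phrase_start ps (Suc i)" for i
    using that assms(1) phrase_start_mono[of "Suc i" j ps] by (cases "j \<le> i") auto
qed (rule assms)

lemma ends_eq:
  assumes "parsing s ps"
  shows "{x. last_of_phrase ps x} = (\<lambda>j. phrase_start ps (Suc j) - 1) ` {..<length ps}"
proof -
  have "0 < phrase_start ps (Suc j)" if "j < length ps" for j
    using phrase_start_strict[OF assms, of 0 "Suc j"] that by simp
  then show ?thesis
    by (force simp: last_of_phrase_def)
qed

text \<open>Phrases are nonempty, so different phrases end at different positions. The size of a
  parsing can thus be found by counting positions.\<close>

lemma card_ends:
  assumes "parsing s ps"
  shows "card {x. last_of_phrase ps x} = length ps"
proof -
  have "inj_on (\<lambda>j. phrase_start ps (Suc j) - 1) {..<length ps}"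
  proof (rule linorder_inj_onI)
    fix i j assume "i < j" "i \<in> {..<length ps}" "j \<in> {..<length ps}"
    then show "phrase_start ps (Suc i) - 1 \<noteq> phrase_start ps (Suc j) - 1"
      using phrase_start_strict[OF assms, of 0 "Suc i"] phrase_start_strict[OF assms, of "Suc i" "Suc j"]
      by auto
  qed auto
  then show ?thesis
    by (simp add: ends_eq[OF assms] card_image)
qed

lemma last_of_phrase_less:
  assumes "parsing s ps" "last_of_phrase ps x"
  shows "x < length s"
proof -
  obtain j where j: "j < length ps" "Suc x = phrase_start ps (Suc j)"
    using assms(2) by (auto simp: last_of_phrase_def)
  have "phrase_start ps (Suc j) \<le> phrase_start ps (length ps)"
    using j by (intro phrase_start_mono) simp
  then show ?thesis
    using j assms(1) by (simp add: phrase_start_def parsing_def)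
qed

lemma phrase_nth:
  assumes "parsing s ps" "j < length ps" "i < length (ps ! j)"
  shows "s ! (phrase_start ps j + i) = ps ! j ! i"
proof -
  have "s = concat (take j ps) @ ps ! j @ concat (drop (Suc j) ps)"
    using assms(1,2) id_take_nth_drop[of j ps]
    by (metis concat.simps(2) concat_append parsing_def)
  then show ?thesis
    using assms(3) by (simp add: phrase_start_def nth_append)
qed

text \<open>
  Read modulo the period \<open>d\<close>, the source of a position in the phrase at \<open>a\<close> lies in the period
  before \<open>a\<close>. Going back by \<open>d\<close> therefore costs one hop if it leaves the phrase, and none otherwise.
\<close>
lemma copy_phrase:
  assumes lz: "lz_parsing s ps src" and x: "x < length s" "\<not> last_of_phrase ps x"
  obtains a d where "0 < d" "d \<le> a" "a \<le> x" "last_of_phrase ps (a - 1)"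
    "\<And>y. a \<le> y \<Longrightarrow> y \<le> x \<Longrightarrow> \<not> last_of_phrase ps y"
    "\<And>y. a \<le> y \<Longrightarrow> y \<le> x \<Longrightarrow> s ! y = s ! (y - d)"
    "\<And>y. a \<le> y \<Longrightarrow> y \<le> x \<Longrightarrow>
       hop ps src y = hop ps src (y - d) + (if y < a + d then 1 else 0)"
proof -
  define j where "j = phrase_index ps x"
  have pars: "parsing s ps"
    using lz by (simp add: lz_parsing_def)
  then have "concat ps = s"
    by (simp add: parsing_def)
  note b = phrase_index_bounds[of x ps, unfolded this, OF x(1), folded j_def]
  define a b d where "a = phrase_start ps j" and "b = src j" and "d = a - b"
  have len: "phrase_start ps (Suc j) = a + length (ps ! j)"
    using b(1) by (simp add: phrase_start_Suc a_def)
  have xe: "Suc x < phrase_start ps (Suc j)"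
    using x(2) b by (metis Suc_lessI last_of_phrase_def)
  then have "length (ps ! j) \<noteq> 1"
    using b len a_def by auto
  then have src: "b < a" "butlast (ps ! j) = take (length (ps ! j) - 1) (drop b s)"
    using lz b(1) by (auto simp: lz_parsing_def a_def b_def)
  have nl: "\<not> last_of_phrase ps y" if "a \<le> y" "y \<le> x" for y
  proof
    assume "last_of_phrase ps y"
    then obtain i where i: "i < length ps" "Suc y = phrase_start ps (Suc i)"
      by (auto simp: last_of_phrase_def)
    show False
    proof (cases "j \<le> i")
      case True
      then show False
        using phrase_start_mono[of "Suc j" "Suc i" ps] i xe that by auto
    next
      case False
      then show False
        using phrase_start_mono[of "Suc i" j ps] i that by (auto simp: a_def)
    qed
  qed
  have sp: "source_pos ps src y = b + (y - a) mod d" if "a \<le> y" "y \<le> x" for y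
  proof -
    have "phrase_index ps y = j"
      using that xe by (intro phrase_index_eq) (auto simp: a_def)
    then show ?thesis
      by (simp add: source_pos_def Let_def a_def b_def d_def)
  qed
  \<comment> \<open>The defining equation of a copied phrase relates \<open>s ! y\<close> to
    \<open>s ! (b + (y - a))\<close>, without reduction modulo \<open>d\<close>; as
    \<open>d = a - b\<close>, this index is \<open>y - d\<close>.\<close>
  have eq: "s ! y = s ! (y - d)" if "a \<le> y" "y \<le> x" for y
  proof -
    have yl: "y - a < length (ps ! j) - 1"
      using that xe len by linarith
    have "s ! y = ps ! j ! (y - a)"
      using phrase_nth[OF pars b(1), of "y - a"] yl that by (simp add: a_def)
    also have "\<dots> = butlast (ps ! j) ! (y - a)"
      using yl by (simp add: nth_butlast)
    also have "\<dots> = s ! (b + (y - a))"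
      using yl that x src(1) by (simp add: src(2))
    also have "b + (y - a) = y - d"
      using that src(1) by (simp add: d_def)
    finally show ?thesis .
  qed
  have hop: "hop ps src y = hop ps src (y - d) + (if y < a + d then 1 else 0)"
    if y: "a \<le> y" "y \<le> x" for y
  proof (cases "y < a + d")
    case True
    then have "source_pos ps src y = y - d"
      using y src(1) by (simp add: sp d_def)
    then show ?thesis
      using True hop_copy[OF lz, of y] nl[OF y] y x by simp
  next
    case False
    then have y': "a \<le> y - d" "y - d \<le> x"
      using y by auto
    \<comment> \<open>From the second period on, \<open>y\<close> and \<open>y - d\<close> have the
      same residue, hence the same source position and the same hop-number.\<close>
    have "(y - a) mod d = (y - d - a) mod d"
      using False by (metis add.commute diff_diff_left le_mod_geq not_less le_diff_conv2 y(1))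
    then have "source_pos ps src y = source_pos ps src (y - d)"
      using y y' by (simp add: sp)
    then show ?thesis
      using False hop_copy[OF lz, of y] hop_copy[OF lz, of "y - d"] nl[OF y] nl[OF y'] y y' x
      by simp
  qed
  \<comment> \<open>A source starts strictly before \<open>a\<close>, so the phrase has a
    predecessor, and \<open>a - 1\<close> is its end.\<close>
  have "j \<noteq> 0"
    using src(1) by (cases j) (auto simp: a_def phrase_start_def)
  then have "last_of_phrase ps (a - 1)"
    using b(1) src(1) by (auto simp: last_of_phrase_def a_def intro!: exI[of _ "j - 1"])
  then show ?thesis
    using that[of d a] src(1) b nl eq hop by (auto simp: d_def a_def)
qed

section \<open>Building parsings\<close>

text \<open>
  \<open>buildable s H N\<close>: phrases whose source does not overlap them suffice to parse \<open>s\<close> into \<open>N\<close>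
  phrases with the hop-numbers \<open>H\<close>. Phrases of length 1 are the case \<open>u = []\<close>.
\<close>
inductive buildable :: "'a list \<Rightarrow> nat list \<Rightarrow> nat \<Rightarrow> bool" where
  nil: "buildable [] [] 0"
| copy: "buildable (x @ u @ y) (f @ g @ h) N \<Longrightarrow> length f = length x \<Longrightarrow> length g = length u \<Longrightarrow>
    buildable ((x @ u @ y) @ u @ [z]) ((f @ g @ h) @ map Suc g @ [0]) (Suc N)"

lemma buildable_length: "buildable s H N \<Longrightarrow> length H = length s"
  by (induction rule: buildable.induct) auto

lemma phrase_start_append: "j \<le> length ps \<Longrightarrow> phrase_start (ps @ qs) j = phrase_start ps j"
  by (simp add: phrase_start_def)

text \<open>Source positions only move to the left, so the recursion for a position of
  \<open>s\<close> never reaches the new phrase. Hop-numbers can therefore be computed while a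
  parsing grows.\<close>

lemma hop_snoc:
  assumes lz: "lz_parsing s ps src" and w: "w \<noteq> []" and p: "p < length s"
  shows "hop (ps @ [w]) (src(length ps := b)) p = hop ps src p"
  using p
proof (induction p rule: less_induct)
  case (less p)
  have pars: "concat ps = s"
    using lz by (simp add: lz_parsing_def parsing_def)
  let ?j = "phrase_index ps p"
  note b = phrase_index_bounds[of p ps, unfolded pars, OF less.prems]
  have idx: "phrase_index (ps @ [w]) p = ?j"
    using b by (intro phrase_index_eq) (simp_all add: phrase_start_append)
  have sp: "source_pos (ps @ [w]) (src(length ps := b)) p = source_pos ps src p"
    using b by (simp add: source_pos_def idx phrase_start_append)
  have "Suc p < phrase_start (ps @ [w]) (Suc (length ps))"
    using less.prems w pars by (cases w) (auto simp: phrase_start_def)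
  then have last: "last_of_phrase (ps @ [w]) p \<longleftrightarrow> last_of_phrase ps p"
    by (auto simp: last_of_phrase_def phrase_start_append less_Suc_eq)
  show ?case
    unfolding hop.simps[of ps src p] hop.simps[of "ps @ [w]" _ p] sp last
    by (intro if_cong refl arg_cong2[of _ _ _ _ "(+)"] less.IH) (use less.prems in auto)
qed

text \<open>The phrase number \<open>N\<close> gets the source start \<open>length x\<close>, the
  place of \<open>u\<close>. As \<open>u\<close> lies entirely before the phrase, every copied
  position has the hop-number of its original plus 1.\<close>

lemma buildable_parsing:
  assumes "buildable s H N"
  shows "\<exists>ps src. lz_parsing s ps src \<and> length ps = N \<and> (\<forall>p<length s. hop ps src p = H ! p)"
  using assms
proof (induction rule: buildable.induct)
  case nil
  show ?case
    by (auto simp: lz_parsing_def parsing_def)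
next
  case (copy x u y f g h N z)
  let ?s = "x @ u @ y" and ?w = "u @ [z]"
  obtain ps src where lz: "lz_parsing ?s ps src" and N: "length ps = N"
    and hop: "\<And>p. p < length ?s \<Longrightarrow> hop ps src p = (f @ g @ h) ! p"
    using copy.IH by blast
  have pars: "concat ps = ?s" "\<forall>w\<in>set ps. w \<noteq> []"
    using lz by (auto simp: lz_parsing_def parsing_def)
  define ps' src' where "ps' = ps @ [?w]" and "src' = src(N := length x)"
  have start: "phrase_start ps' j = phrase_start ps j" if "j \<le> N" for j
    using that N by (simp add: ps'_def phrase_start_append)
  have startN: "phrase_start ps' N = length ?s" "phrase_start ps' (Suc N) = length ?s + Suc (length u)"
    using N pars(1) by (simp_all add: ps'_def phrase_start_def)
  have lz': "lz_parsing (?s @ ?w) ps' src'"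
    unfolding lz_parsing_def
  proof (intro conjI allI impI)
    show "parsing (?s @ ?w) ps'"
      using pars by (auto simp: parsing_def ps'_def)
    fix j assume j: "j < length ps'"
    show "length (ps' ! j) = 1 \<or> src' j < phrase_start ps' j \<and>
      butlast (ps' ! j) = take (length (ps' ! j) - 1) (drop (src' j) (?s @ ?w))"
    proof (cases "j = N")
      case True
      \<comment> \<open>If \<open>u\<close> is empty, the phrase has length 1, and its source start
        \<open>length x\<close>, possibly equal to the phrase start, is irrelevant.\<close>
      then show ?thesis
        using N startN by (auto simp: ps'_def src'_def)
    next
      case False
      then have jN: "j < N"
        using j N by (simp add: ps'_def)
      have len: "phrase_start ps j + length (ps ! j) \<le> length ?s"
        using phrase_start_mono[of "Suc j" N ps] jN N pars(1)
        by (simp add: phrase_start_Suc) (simp add: phrase_start_def)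
      have "length (ps ! j) = 1 \<or> src j < phrase_start ps j \<and>
          butlast (ps ! j) = take (length (ps ! j) - 1) (drop (src j) ?s)"
        using lz jN N by (simp add: lz_parsing_def)
      then show ?thesis
        using jN N len start[of j] by (auto simp: ps'_def src'_def nth_append)
    qed
  qed
  have "hop ps' src' p = ((f @ g @ h) @ map Suc g @ [0]) ! p" if p: "p < length (?s @ ?w)" for p
  proof -
    have len: "length (f @ g @ h) = length ?s"
      using buildable_length[OF copy.hyps(1)] .
    consider "p < length ?s" | t where "t < length u" "p = length ?s + t" | "p = length ?s + length u"
      using p by (metis Suc_eq_plus1 length_append length_append_singleton less_Suc_eq
          add.assoc not_less le_Suc_ex nat_add_left_cancel_less)
    then show ?thesis
    proof cases
      case 1
      then have "hop ps' src' p = hop ps src p"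
        using hop_snoc[OF lz, of ?w p "length x"] N by (simp add: ps'_def src'_def)
      then show ?thesis
        using 1 hop[OF 1] len by (metis nth_append)
    next
      case 2
      have nl: "\<not> last_of_phrase ps' p"
      proof
        assume "last_of_phrase ps' p"
        then obtain i where i: "i < length ps'" "Suc p = phrase_start ps' (Suc i)"
          by (auto simp: last_of_phrase_def)
        then show False
          using 2 startN phrase_start_mono[of "Suc i" N ps'] N
          by (cases "i = N") (auto simp: ps'_def)
      qed
      have "phrase_index ps' p = N"
        using 2 startN by (intro phrase_index_eq) auto
      \<comment> \<open>The distance from source to phrase start is
        \<open>length u + length y\<close>, which exceeds \<open>t\<close>, so the reduction modulo
        it does nothing.\<close>
      then have sp: "source_pos ps' src' p = length x + t"
        using 2 startN by (simp add: source_pos_def src'_def)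
      have "hop ps' src' p = hop ps' src' (length x + t) + 1"
        using hop_copy[OF lz' p nl] sp by simp
      also have "hop ps' src' (length x + t) = hop ps src (length x + t)"
        using hop_snoc[OF lz, of ?w "length x + t" "length x"] N 2 by (simp add: ps'_def src'_def)
      also have "\<dots> = g ! t"
        using hop[of "length x + t"] 2 copy.hyps by (simp add: nth_append)
      finally show ?thesis
        using 2 copy.hyps len by (simp add: nth_append)
    next
      case 3
      then have "last_of_phrase ps' p"
        using startN N by (auto simp: last_of_phrase_def ps'_def intro!: exI[of _ N])
      then show ?thesis
        using 3 copy.hyps len by (simp add: hop_last nth_append)
    qed
  qed
  then show ?case
    using lz' N by (intro exI[of _ ps'] exI[of _ src']) (auto simp: ps'_def)
qed

lemma buildable_copyI:
  assumes "buildable s H N" "s = x @ u @ y" "H = f @ g @ h" "length f = length x" "length g = length u"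
    "s' = s @ u @ [z]" "H' = H @ map Suc g @ [0]"
  shows "buildable s' H' (Suc N)"
  using buildable.copy[of x u y f g h N z] assms by simp

lemma buildable_singleton: "buildable s H N \<Longrightarrow> buildable (s @ [z]) (H @ [0]) (Suc N)"
  by (rule buildable_copyI[of s H N s "[]" "[]" H "[]" "[]"]) (auto simp: buildable_length)

lemma buildable_singletons:
  "buildable s H N \<Longrightarrow> buildable (s @ w) (H @ replicate (length w) 0) (N + length w)"
proof (induction w rule: rev_induct)
  case (snoc z w)
  then show ?case
    using buildable_singleton[of "s @ w" "H @ replicate (length w) 0" "N + length w" z]
    by (simp add: replicate_append_same flip: replicate_Suc)
qed simp

section \<open>From vertex covers to parsings\<close>

abbreviation X_block :: "'v \<Rightarrow> 'v symb list" where
  "X_block v \<equiv> [Vert' v, Vert v, HashV v]"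

abbreviation Y_block :: "'v \<times> 'v \<Rightarrow> 'v symb list" where
  "Y_block e \<equiv> [Vert' (fst e), Vert (fst e), Edge e, Dollar e,
     Vert' (snd e), Vert (snd e), Edge e, Dollar e, HashE e]"

lemma X_str_simps:
  "X_str [] = []" "X_str (v # vs) = X_block v @ X_str vs"
  "X_str (vs @ ws) = X_str vs @ X_str ws"
  by (simp_all add: X_str_def)

lemma Y_str_simps:
  "Y_str [] = []" "Y_str (e # es) = Y_block e @ Y_str es"
  "Y_str (es @ fs) = Y_str es @ Y_str fs"
  by (simp_all add: Y_str_def split: prod.split)

lemma length_concat_pairs: "length (concat (map2 (\<lambda>x t. [x, f t]) xs ts)) = 2 * min (length xs) (length ts)"
proof (induction xs arbitrary: ts)
  case (Cons x xs)
  then show ?case by (cases ts) auto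
qed simp

lemma length_P_str: "length (P_str vs es) = 2 * (length vs + length es)"
  unfolding P_str_def length_concat_pairs by (simp del: upt_Suc)

lemma set_concat_pairs:
  "length xs = length ts \<Longrightarrow> set (concat (map2 (\<lambda>x t. [x, f t]) xs ts)) = set xs \<union> f ` set ts"
  by (induction xs ts rule: list_induct2) auto

lemma set_P_str:
  "set (P_str vs es) = Vert ` set vs \<union> Edge ` set es \<union> HashP ` {1..length vs + length es}"
  unfolding P_str_def by (subst set_concat_pairs) (auto simp del: upt_Suc)

text \<open>\<open>P_str\<close> is cut into single symbols. The block of \<open>v\<close> takes
  three single symbols if \<open>v\<close> is in \<open>C\<close>; otherwise two phrases, the second
  copying \<open>Vert v\<close> from \<open>P_str\<close>, so that only this symbol has hop-number
  1.\<close>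

lemma buildable_X_str:
  assumes "set ws \<subseteq> set vs"
  shows "buildable (P_str vs es @ X_str ws)
    (replicate (length (P_str vs es)) 0 @ concat (map (\<lambda>v. if v \<in> C then [0, 0, 0] else [0, 1, 0]) ws))
    (length (P_str vs es) + 2 * length ws + length (filter (\<lambda>v. v \<in> C) ws))"
    (is "buildable (?P @ X_str ws) (?Z @ concat (map ?h ws)) _")
  using assms
proof (induction ws rule: rev_induct)
  case Nil
  show ?case
    using buildable_singletons[OF buildable.nil, of ?P] by (simp add: X_str_simps)
next
  case (snoc v ws)
  define s H N where "s = ?P @ X_str ws" and "H = ?Z @ concat (map ?h ws)"
    and "N = length ?P + 2 * length ws + length (filter (\<lambda>v. v \<in> C) ws)"
  have b: "buildable s H N"
    using snoc by (simp add: s_def H_def N_def)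
  show ?case
  proof (cases "v \<in> C")
    case True
    then show ?thesis
      using buildable_singletons[OF b, of "X_block v"]
      by (simp add: s_def H_def N_def X_str_simps numeral_3_eq_3)
  next
    case False
    have "Vert v \<in> set ?P"
      using snoc.prems by (auto simp: set_P_str)
    then obtain x y where P: "?P = x @ [Vert v] @ y"
      by (metis append_Cons append_Nil split_list)
    have "buildable (s @ X_block v) (H @ [0, 1, 0]) (Suc (Suc N))"
    proof (rule buildable_copyI)
      show "buildable (s @ [Vert' v]) (H @ [0]) (Suc N)"
        by (rule buildable_singleton) (rule b)
      show "s @ [Vert' v] = x @ [Vert v] @ (y @ X_str ws @ [Vert' v])"
        by (simp add: s_def P)
      show "H @ [0] = replicate (length x) 0 @ [0] @ (replicate (length y) 0 @ concat (map ?h ws) @ [0])"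
        by (simp add: H_def P replicate_add replicate_app_Cons_same replicate_append_same)
    qed auto
    then show ?thesis
      using False by (simp add: s_def H_def N_def X_str_simps)
  qed
qed

text \<open>
  An edge gadget takes four phrases: the end covered by \<open>C\<close> is copied as \<open>v' v e\<close> from a block of
  \<open>X_str\<close> with hop-numbers 0, and the other end as \<open>v' v\<close>.
\<close>
lemma buildable_Y_step:
  assumes b: "buildable (P @ X @ W) (replicate (length P) 0 @ G @ K) N"
    and Edge: "Edge e \<in> set P"
    and p: "X = x @ X_block (fst e) @ y" "G = f @ (if fst e \<in> C then [0, 0, 0] else [0, 1, 0]) @ g"
      "length f = length x"
    and q: "X = x' @ X_block (snd e) @ y'" "G = f' @ (if snd e \<in> C then [0, 0, 0] else [0, 1, 0]) @ g'"
      "length f' = length x'"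
    and C: "fst e \<in> C \<or> snd e \<in> C"
  shows "\<exists>J. buildable (P @ X @ W @ Y_block e) (replicate (length P) 0 @ G @ K @ J) (N + 4) \<and>
    (\<forall>j\<in>set J. j \<le> 1)"
proof -
  define s H where "s = P @ X @ W" and "H = replicate (length P) 0 @ G @ K"
  have b: "buildable s H N"
    using b by (simp add: s_def H_def)
  have len: "length H = length s"
    using buildable_length[OF b] .
  show ?thesis
  proof (cases "fst e \<in> C")
    case True
    \<comment> \<open>The phrases are \<open>v_p' v_p e\<close>, \<open>$\<close>,
      \<open>v_q' v_q\<close> and \<open>e $ #\<close>. The third copies only \<open>v_q'\<close>,
      which has hop-number 0 whether or not \<open>snd e\<close> is in \<open>C\<close>; the fourth
      copies the first \<open>e $\<close> of this gadget, both symbols of which end phrases.\<close>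
    have "buildable (s @ [Vert' (fst e), Vert (fst e), Edge e]) (H @ [1, 1, 0]) (Suc N)"
      by (rule buildable_copyI[OF b, of "P @ x" "[Vert' (fst e), Vert (fst e)]" "HashV (fst e) # y @ W"
            "replicate (length P) 0 @ f" "[0, 0]" "0 # g @ K"])
        (use True in \<open>auto simp: s_def H_def p\<close>)
    then have "buildable (s @ [Vert' (fst e), Vert (fst e), Edge e, Dollar e])
        (H @ [1, 1, 0, 0]) (Suc (Suc N))"
      using buildable_singleton by fastforce
    then have "buildable (s @ [Vert' (fst e), Vert (fst e), Edge e, Dollar e, Vert' (snd e), Vert (snd e)])
        (H @ [1, 1, 0, 0, 1, 0]) (Suc (Suc (Suc N)))"
      by (rule buildable_copyI[where x = "P @ x'" and u = "[Vert' (snd e)]"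
            and y = "[Vert (snd e), HashV (snd e)] @ y' @ W @ [Vert' (fst e), Vert (fst e), Edge e, Dollar e]"
            and f = "replicate (length P) 0 @ f'" and g = "[0]"
            and h = "(if snd e \<in> C then [0, 0] else [1, 0]) @ g' @ K @ [1, 1, 0, 0]"])
        (auto simp: s_def H_def q)
    then have "buildable (s @ Y_block e) (H @ [1, 1, 0, 0, 1, 0, 1, 1, 0]) (Suc (Suc (Suc (Suc N))))"
      by (rule buildable_copyI[where x = "s @ [Vert' (fst e), Vert (fst e)]" and u = "[Edge e, Dollar e]"
            and y = "[Vert' (snd e), Vert (snd e)]" and f = "H @ [1, 1]" and g = "[0, 0]" and h = "[1, 0]"])
        (auto simp: len)
    then show ?thesis
      by (intro exI[of _ "[1, 1, 0, 0, 1, 0, 1, 1, 0]"]) (simp add: s_def H_def numeral_eq_Suc)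
  next
    case False
    with C have snd: "snd e \<in> C"
      by simp
    obtain z z' where P: "P = z @ Edge e # z'"
      using split_list[OF Edge] by blast
    \<comment> \<open>Here the phrases are \<open>v_p' v_p\<close>, \<open>e $\<close>,
      \<open>v_q' v_q e\<close> and \<open>$ #\<close>. The first \<open>e\<close> is copied from
      \<open>P\<close>, and the second \<open>$\<close> from the first one.\<close>
    have "buildable (s @ [Vert' (fst e), Vert (fst e)]) (H @ [1, 0]) (Suc N)"
      by (rule buildable_copyI[OF b, of "P @ x" "[Vert' (fst e)]" "[Vert (fst e), HashV (fst e)] @ y @ W"
            "replicate (length P) 0 @ f" "[0]" "[1, 0] @ g @ K"])
        (use False in \<open>auto simp: s_def H_def p\<close>)
    then have "buildable (s @ [Vert' (fst e), Vert (fst e), Edge e, Dollar e])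
        (H @ [1, 0, 1, 0]) (Suc (Suc N))"
      by (rule buildable_copyI[where x = z and u = "[Edge e]"
            and y = "z' @ X @ W @ [Vert' (fst e), Vert (fst e)]"
            and f = "replicate (length z) 0" and g = "[0]"
            and h = "replicate (length z') 0 @ G @ K @ [1, 0]"])
        (auto simp: s_def H_def P replicate_add replicate_app_Cons_same replicate_append_same)
    then have "buildable (s @ [Vert' (fst e), Vert (fst e), Edge e, Dollar e, Vert' (snd e), Vert (snd e), Edge e])
        (H @ [1, 0, 1, 0, 1, 1, 0]) (Suc (Suc (Suc N)))"
      by (rule buildable_copyI[where x = "P @ x'" and u = "[Vert' (snd e), Vert (snd e)]"
            and y = "HashV (snd e) # y' @ W @ [Vert' (fst e), Vert (fst e), Edge e, Dollar e]"
            and f = "replicate (length P) 0 @ f'" and g = "[0, 0]"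
            and h = "0 # g' @ K @ [1, 0, 1, 0]"])
        (use snd in \<open>auto simp: s_def H_def q\<close>)
    then have "buildable (s @ Y_block e) (H @ [1, 0, 1, 0, 1, 1, 0, 1, 0]) (Suc (Suc (Suc (Suc N))))"
      by (rule buildable_copyI[where x = "s @ [Vert' (fst e), Vert (fst e), Edge e]" and u = "[Dollar e]"
            and y = "[Vert' (snd e), Vert (snd e), Edge e]" and f = "H @ [1, 0, 1]" and g = "[0]" and h = "[1, 1, 0]"])
        (auto simp: len)
    then show ?thesis
      by (intro exI[of _ "[1, 0, 1, 0, 1, 1, 0, 1, 0]"]) (simp add: s_def H_def numeral_eq_Suc)
  qed
qed

text \<open>The size adds up from 2(n+m) phrases for \<open>P_str\<close>, 2n plus one per vertex of
  \<open>C\<close> for \<open>X_str\<close>, and 4m for \<open>Y_str\<close>.\<close>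

lemma buildable_base:
  assumes ends: "\<forall>e\<in>set es. fst e \<in> set vs \<and> snd e \<in> set vs"
    and C: "\<forall>e\<in>set es. fst e \<in> C \<or> snd e \<in> C"
  shows "\<exists>H. buildable (P_str vs es @ X_str vs @ Y_str es) H
      (4 * length vs + 6 * length es + length (filter (\<lambda>v. v \<in> C) vs)) \<and> (\<forall>h\<in>set H. h \<le> 1)"
proof -
  define P X where "P = P_str vs es" and "X = X_str vs"
  define h :: "'a \<Rightarrow> nat list" where "h v = (if v \<in> C then [0, 0, 0] else [0, 1, 0])" for v
  define G where "G = concat (map h vs)"
  define N where "N = length P + 2 * length vs + length (filter (\<lambda>v. v \<in> C) vs)"
  have X: "buildable (P @ X) (replicate (length P) 0 @ G) N"
    using buildable_X_str[of vs vs es C] by (simp add: P_def X_def G_def N_def h_def[abs_def])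
  have split: "\<exists>x y f g. X = x @ X_block v @ y \<and> G = f @ h v @ g \<and> length f = length x"
    if v: "v \<in> set vs" for v
  proof -
    obtain us ws where "vs = us @ v # ws"
      using split_list[OF v] by blast
    moreover have "length (concat (map h us)) = length (X_str us)"
      by (induction us) (auto simp: X_str_simps h_def)
    ultimately show ?thesis
      by (intro exI[of _ "X_str us"] exI[of _ "X_str ws"] exI[of _ "concat (map h us)"]
          exI[of _ "concat (map h ws)"]) (simp add: X_def G_def X_str_simps)
  qed
  have "\<exists>K. buildable (P @ X @ Y_str fs) (replicate (length P) 0 @ G @ K) (N + 4 * length fs) \<and>
      (\<forall>j\<in>set K. j \<le> 1)" if "set fs \<subseteq> set es" for fs
    using that
  proof (induction fs rule: rev_induct)
    case Nil
    then show ?case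
      using X by (intro exI[of _ "[]"]) (simp add: Y_str_simps)
  next
    case (snoc e fs)
    then have "set fs \<subseteq> set es"
      by simp
    then obtain K where K: "buildable (P @ X @ Y_str fs) (replicate (length P) 0 @ G @ K) (N + 4 * length fs)"
      "\<forall>j\<in>set K. j \<le> 1"
      using snoc.IH by blast
    have e: "e \<in> set es" "Edge e \<in> set P"
      using snoc.prems by (auto simp: P_def set_P_str)
    obtain x y f g where p: "X = x @ X_block (fst e) @ y" "G = f @ h (fst e) @ g" "length f = length x"
      using split[of "fst e"] ends e(1) by blast
    obtain x' y' f' g' where q: "X = x' @ X_block (snd e) @ y'" "G = f' @ h (snd e) @ g'" "length f' = length x'"
      using split[of "snd e"] ends e(1) by blast
    from buildable_Y_step[OF K(1) e(2) p(1) p(2)[unfolded h_def] p(3) q(1) q(2)[unfolded h_def] q(3)] C e(1)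
    obtain J where "buildable (P @ X @ Y_str fs @ Y_block e) (replicate (length P) 0 @ G @ K @ J)
        (N + 4 * length fs + 4)" "\<forall>j\<in>set J. j \<le> 1"
      by blast
    then show ?case
      using K(2) by (intro exI[of _ "K @ J"]) (auto simp: Y_str_simps ac_simps)
  qed
  from this[OF subset_refl] obtain K where
    "buildable (P @ X @ Y_str es) (replicate (length P) 0 @ G @ K) (N + 4 * length es)" "\<forall>j\<in>set K. j \<le> 1"
    by blast
  moreover have "\<forall>j\<in>set G. j \<le> 1"
    by (auto simp: G_def h_def)
  moreover have "N + 4 * length es = 4 * length vs + 6 * length es + length (filter (\<lambda>v. v \<in> C) vs)"
    by (simp add: N_def P_def length_P_str)
  ultimately show ?thesis
    by (intro exI[of _ "replicate (length P) 0 @ G @ K"]) (auto simp: P_def X_def)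
qed

section \<open>Parsing the levels of the recursion\<close>

lemma alpha_Suc: "1 \<le> i \<Longrightarrow> alpha s l (Suc i) = alpha s l i @ beta l i (alpha s l i)"
  by (cases i) auto

lemma beta_Suc: "beta (Suc g) i w = beta g i w @ w @ [HashL i (Suc g)]"
  by (simp add: beta_def)

text \<open>Each copy of \<open>A\<close> together with its separator is one phrase. Its source is
  always the prefix \<open>A\<close>, never another copy, so all the \<open>l\<close> copies of a
  level raise the bound by 1 only once.\<close>

lemma buildable_alpha:
  assumes "buildable s H N" "\<forall>h\<in>set H. h \<le> 1"
  shows "\<exists>H. buildable (alpha s l (Suc i)) H (N + l * i) \<and> (\<forall>h\<in>set H. h \<le> Suc i)"
proof (induction i)
  case 0
  then show ?case
    using assms by auto
next
  case (Suc i)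
  define A where "A = alpha s l (Suc i)"
  obtain H where H: "buildable A H (N + l * i)" "\<forall>h\<in>set H. h \<le> Suc i"
    using Suc by (auto simp: A_def)
  have len: "length H = length A"
    using buildable_length[OF H(1)] .
  have "\<exists>K. buildable (A @ beta g (Suc i) A) (H @ K) (N + l * i + g) \<and> (\<forall>h\<in>set K. h \<le> Suc (Suc i))" for g
  proof (induction g)
    case 0
    then show ?case
      using H by (intro exI[of _ "[]"]) (simp add: beta_def)
  next
    case (Suc g)
    then obtain K where K: "buildable (A @ beta g (Suc i) A) (H @ K) (N + l * i + g)"
      "\<forall>h\<in>set K. h \<le> Suc (Suc i)"
      by blast
    have "buildable (A @ beta (Suc g) (Suc i) A) (H @ K @ map Suc H @ [0]) (Suc (N + l * i + g))"
      by (rule buildable_copyI[OF K(1), of "[]" A _ "[]" H])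
        (auto simp: beta_Suc len)
    then show ?case
      using K(2) H(2) by (intro exI[of _ "K @ map Suc H @ [0]"]) auto
  qed
  from this[of l] obtain K where "buildable (A @ beta l (Suc i) A) (H @ K) (N + l * i + l)"
    "\<forall>h\<in>set K. h \<le> Suc (Suc i)"
    by blast
  then show ?case
    using H(2) by (intro exI[of _ "H @ K"]) (auto simp: A_def algebra_simps le_SucI)
qed

lemma vertex_cover_imp_blz_parsing:
  assumes "\<forall>e\<in>set es. fst e \<in> set vs \<and> snd e \<in> set vs" "\<forall>e\<in>set es. fst e \<in> C \<or> snd e \<in> C"
    and "distinct vs" "C \<subseteq> set vs" "1 \<le> c"
  shows "\<exists>ps src. blz_parsing c (graph_string vs es c l) ps src \<and>
    length ps = 4 * length vs + 6 * length es + card C + l * (c - 1)"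
proof -
  define N where "N = 4 * length vs + 6 * length es + length (filter (\<lambda>v. v \<in> C) vs)"
  obtain H0 where "buildable (P_str vs es @ X_str vs @ Y_str es) H0 N" "\<forall>h\<in>set H0. h \<le> 1"
    using buildable_base[OF assms(1,2)] by (auto simp: N_def)
  from buildable_alpha[OF this, of l "c - 1"]
  obtain H where H: "buildable (graph_string vs es c l) H (N + l * (c - 1))" "\<forall>h\<in>set H. h \<le> c"
    using assms(5) by (auto simp: graph_string_def)
  obtain ps src where ps: "lz_parsing (graph_string vs es c l) ps src" "length ps = N + l * (c - 1)"
    "\<forall>p<length (graph_string vs es c l). hop ps src p = H ! p"
    using buildable_parsing[OF H(1)] by blast
  have "hop ps src p \<le> c" if "p < length (graph_string vs es c l)" for p
    using ps(3) that H(2) buildable_length[OF H(1)] nth_mem[of p H] by metis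
  then have "blz_parsing c (graph_string vs es c l) ps src"
    using ps(1) by (simp add: blz_parsing_def)
  moreover have "{x \<in> set vs. x \<in> C} = C"
    using assms(4) by blast
  then have "length (filter (\<lambda>v. v \<in> C) vs) = card C"
    using distinct_card[of "filter (\<lambda>v. v \<in> C) vs"] assms(3) by simp
  ultimately show ?thesis
    using ps(2) by (intro exI[of _ ps] exI[of _ src]) (simp add: N_def)
qed

section \<open>Block structure of the string\<close>

text \<open>Used with sets of block shapes that do not mention \<open>vs\<close>, \<open>es\<close>
  or the order of the blocks: neighbours of a symbol are read off from the block around it.\<close>

definition block_string :: "'a list set \<Rightarrow> 'a list \<Rightarrow> bool" where
  "block_string B w \<longleftrightarrow> (\<exists>bs. w = concat bs \<and> set bs \<subseteq> B)"

lemma block_string_Nil: "block_string B []"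
  by (auto simp: block_string_def intro!: exI[of _ "[]"])

lemma block_string_append: "block_string B v \<Longrightarrow> block_string B w \<Longrightarrow> block_string B (v @ w)"
  unfolding block_string_def by (metis concat_append set_append Un_least)

lemma block_string_single: "b \<in> B \<Longrightarrow> block_string B b"
  by (auto simp: block_string_def intro!: exI[of _ "[b]"])

lemma block_string_mono: "block_string B w \<Longrightarrow> B \<subseteq> C \<Longrightarrow> block_string C w"
  by (auto simp: block_string_def)

lemma block_string_nth:
  assumes "block_string B w" "x < length w"
  obtains b j q where "b \<in> B" "j < length b" "x = q + j" "q + length b \<le> length w"
    "\<And>t. t < length b \<Longrightarrow> w ! (q + t) = b ! t"
proof -
  obtain bs where "w = concat bs" "set bs \<subseteq> B"
    using assms(1) by (auto simp: block_string_def)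
  then have "\<exists>b q j. b \<in> B \<and> j < length b \<and> x = q + j \<and> q + length b \<le> length w \<and>
      (\<forall>t<length b. w ! (q + t) = b ! t)"
    using assms(2)
  proof (induction bs arbitrary: w rule: rev_induct)
    case (snoc b bs)
    let ?v = "concat bs"
    show ?case
    proof (cases "x < length ?v")
      case True
      then obtain b' q j where "b' \<in> B" "j < length b'" "x = q + j" "q + length b' \<le> length ?v"
        "\<forall>t<length b'. ?v ! (q + t) = b' ! t"
        using snoc.IH[of ?v] snoc.prems(2) by auto
      then show ?thesis
        using snoc.prems(1) by (intro exI[of _ b'] exI[of _ q] exI[of _ j]) (auto simp: nth_append)
    next
      case False
      then show ?thesis
        using snoc.prems by (intro exI[of _ b] exI[of _ "length ?v"] exI[of _ "x - length ?v"]) auto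
    qed
  qed simp
  then show ?thesis
    using that by blast
qed

definition P_blocks :: "'v symb list set" where
  "P_blocks = {[Vert v, HashP t] |v t. True} \<union> {[Edge e, HashP t] |e t. True}"

definition X_blocks :: "'v symb list set" where
  "X_blocks = range X_block"

definition Y_blocks :: "'v symb list set" where
  "Y_blocks = range Y_block"

definition L_blocks :: "'v symb list set" where
  "L_blocks = {[HashL i g] |i g. True}"

lemma block_string_P: "block_string P_blocks (P_str vs es)"
proof -
  have "block_string P_blocks (concat (map2 (\<lambda>x t. [x, HashP t]) xs ts))"
    if "set xs \<subseteq> range Vert \<union> range Edge" for xs :: "'a symb list" and ts
    using that
  proof (induction xs arbitrary: ts)
    case (Cons x xs)
    then show ?case
    proof (cases ts)
      case (Cons t us)
      have "[x, HashP t] \<in> P_blocks"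
        using Cons.prems by (auto simp: P_blocks_def)
      then show ?thesis
        using Cons.IH[of us] Cons.prems block_string_append[OF block_string_single] Cons
        by fastforce
    qed (simp add: block_string_Nil)
  qed (simp add: block_string_Nil)
  from this[of "map Vert vs @ map Edge es"] show ?thesis
    unfolding P_str_def by (auto simp del: upt_Suc)
qed

lemma block_string_X: "block_string X_blocks (X_str vs)"
  unfolding block_string_def X_str_def X_blocks_def by (intro exI[of _ "map X_block vs"]) auto

lemma block_string_Y: "block_string Y_blocks (Y_str es)"
proof (induction es)
  case (Cons e es)
  then show ?case
    unfolding Y_str_simps Y_blocks_def by (intro block_string_append[OF block_string_single]) auto
qed (simp add: Y_str_simps block_string_Nil)

lemma block_string_beta:
  assumes "block_string B w" "L_blocks \<subseteq> B"
  shows "block_string B (beta l i w)"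
proof (induction l)
  case (Suc l)
  have "[HashL i (Suc l)] \<in> B"
    using assms(2) by (auto simp: L_blocks_def)
  then show ?case
    unfolding beta_Suc by (intro block_string_append Suc assms block_string_single)
qed (simp add: beta_def block_string_Nil)

lemma block_string_alpha:
  assumes "block_string B w" "L_blocks \<subseteq> B"
  shows "block_string B (alpha w l i)"
  using assms
proof (induction w l i rule: alpha.induct)
  case (3 w l i)
  then show ?case
    by (auto intro: block_string_append block_string_beta)
qed (simp_all add: block_string_Nil)

lemma set_beta: "set (beta l i w) = (if l = 0 then {} else set w) \<union> HashL i ` {1..l}"
proof (induction l)
  case (Suc l)
  then show ?case
    unfolding beta_Suc by (auto simp: atLeastAtMostSuc_conv)
qed (simp add: beta_def)

lemma set_alpha:
  assumes "1 \<le> i"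
  shows "set (alpha w l i) = set w \<union> case_prod HashL ` ({1..<i} \<times> {1..l})"
  using assms
proof (induction i rule: dec_induct)
  case (step i)
  have "{1..<Suc i} = insert i {1..<i}"
    using step by auto
  then show ?case
    using step by (auto simp: alpha_Suc set_beta)
qed simp

lemma alpha_prefix:
  assumes "1 \<le> i" "i \<le> j"
  shows "\<exists>w. alpha s l j = alpha s l i @ w"
  using assms(2)
proof (induction j rule: dec_induct)
  case (step j)
  then show ?case
    using assms(1) by (auto simp: alpha_Suc)
qed simp

lemma beta_split:
  assumes "1 \<le> g" "g \<le> l"
  shows "\<exists>u v. beta l i w = u @ w @ [HashL i g] @ v"
proof -
  have "g \<in> set [1..<Suc l]"
    using assms by auto
  then obtain xs ys where "[1..<Suc l] = xs @ g # ys"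
    by (meson split_list)
  then show ?thesis
    unfolding beta_def
    by (intro exI[of _ "concat (map (\<lambda>g. w @ [HashL i g]) xs)"]
        exI[of _ "concat (map (\<lambda>g. w @ [HashL i g]) ys)"]) (simp del: upt_Suc)
qed

lemma beta_prefix: "1 \<le> l \<Longrightarrow> \<exists>v. beta l i w = w @ v"
proof (induction l rule: dec_induct)
  case base
  show ?case
    by (simp add: beta_def)
next
  case (step l)
  then show ?case
    by (auto simp: beta_Suc)
qed

text \<open>Lets the single symbol \<open>last u\<close> certify an occurrence of the whole string
  \<open>u\<close> ending there; applied to \<open>u = alpha w l i\<close>.\<close>

definition ends_aligned :: "'a list \<Rightarrow> 'a list \<Rightarrow> bool" where
  "ends_aligned u w \<longleftrightarrow>
    (\<forall>x<length w. w ! x = last u \<longrightarrow> (\<exists>y z. w = y @ u @ z \<and> Suc x = length (y @ u)))"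

lemma ends_aligned_append:
  assumes "ends_aligned u v" "ends_aligned u w"
  shows "ends_aligned u (v @ w)"
  unfolding ends_aligned_def
proof (intro allI impI)
  fix x assume x: "x < length (v @ w)" "(v @ w) ! x = last u"
  show "\<exists>y z. v @ w = y @ u @ z \<and> Suc x = length (y @ u)"
  proof (cases "x < length v")
    case True
    then obtain y z where "v = y @ u @ z" "Suc x = length (y @ u)"
      using assms(1) x by (auto simp: ends_aligned_def nth_append)
    then show ?thesis
      by (intro exI[of _ y] exI[of _ "z @ w"]) simp
  next
    case False
    then have "x - length v < length w" "w ! (x - length v) = last u"
      using x by (auto simp: nth_append)
    then obtain y z where "w = y @ u @ z" "Suc (x - length v) = length (y @ u)"
      using assms(2) unfolding ends_aligned_def by blast
    then show ?thesis
      using False by (intro exI[of _ "v @ y"] exI[of _ z]) simp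
  qed
qed

lemma ends_aligned_self:
  assumes "last u \<notin> set (butlast u)"
  shows "ends_aligned u u"
  unfolding ends_aligned_def
proof (intro allI impI)
  fix x assume x: "x < length u" "u ! x = last u"
  have "\<not> x < length u - 1"
    using x assms by (metis length_butlast nth_butlast nth_mem)
  then show "\<exists>y z. u = y @ u @ z \<and> Suc x = length (y @ u)"
    using x by (intro exI[of _ "[]"]) auto
qed

text \<open>Higher levels only concatenate copies of lower ones and separators of level at least
  \<open>i\<close>. Separators inside \<open>alpha w l i\<close> have level below \<open>i\<close>,
  so the new ones never equal its last symbol.\<close>

lemma ends_aligned_alpha:
  assumes last: "last (alpha w l i) \<notin> set (butlast (alpha w l i))" "alpha w l i \<noteq> []"
    and i: "1 \<le> i" "i \<le> j" and w: "range (case_prod HashL) \<inter> set w = {}"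
  shows "ends_aligned (alpha w l i) (alpha w l j)"
  using i(2)
proof (induction j rule: dec_induct)
  case base
  then show ?case
    by (rule ends_aligned_self) (rule last)
next
  case (step j)
  have "last (alpha w l i) \<in> set (alpha w l i)"
    using last(2) by simp
  then have ne: "last (alpha w l i) \<noteq> HashL j g" for g
    using w step.hyps unfolding set_alpha[OF i(1)] by force
  have sep: "ends_aligned (alpha w l i) [HashL j g]" for g
    using ne[of g] by (auto simp: ends_aligned_def)
  have "ends_aligned (alpha w l i) (beta m j (alpha w l j))" for m
  proof (induction m)
    case (Suc m)
    then show ?case
      unfolding beta_Suc by (intro ends_aligned_append sep step.IH)
  qed (simp add: beta_def ends_aligned_def)
  then show ?case
    using step i(1) by (simp add: alpha_Suc ends_aligned_append)
qed

section \<open>Symbols and neighbourhoods in the string of a graph\<close>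

locale gadget =
  fixes vs :: "'v list" and es :: "('v \<times> 'v) list" and c l :: nat
  assumes distinct: "distinct vs" "distinct es"
    and endpoints: "\<And>e. e \<in> set es \<Longrightarrow> fst e \<in> set vs \<and> snd e \<in> set vs \<and> fst e \<noteq> snd e"
    and c_pos: "1 \<le> c" and l_pos: "1 \<le> l"
begin

definition s1 :: "'v symb list" where
  "s1 = P_str vs es @ X_str vs @ Y_str es"

abbreviation A :: "nat \<Rightarrow> 'v symb list" where
  "A i \<equiv> alpha s1 l i"

definition s :: "'v symb list" where
  "s = graph_string vs es c l"

lemma s_eq: "s = A c"
  by (simp add: s_def graph_string_def s1_def)

lemma A_prefix:
  assumes "1 \<le> i" "i \<le> c"
  shows "\<exists>w. s = A i @ w"
  using alpha_prefix[OF assms] by (simp add: s_eq)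

lemma s1_prefix: "\<exists>w. s = s1 @ w"
  using A_prefix[of 1] c_pos by simp

lemma set_s1: "set s1 = Vert ` set vs \<union> Vert' ` set vs \<union> HashV ` set vs \<union>
    Edge ` set es \<union> Dollar ` set es \<union> HashE ` set es \<union> HashP ` {1..length vs + length es}"
proof -
  have "set (X_str ws) = Vert ` set ws \<union> Vert' ` set ws \<union> HashV ` set ws" for ws :: "'v list"
    by (induction ws) (auto simp: X_str_simps)
  moreover have "set (Y_str fs) = (Vert \<circ> fst) ` set fs \<union> (Vert' \<circ> fst) ` set fs \<union>
      (Vert \<circ> snd) ` set fs \<union> (Vert' \<circ> snd) ` set fs \<union>
      Edge ` set fs \<union> Dollar ` set fs \<union> HashE ` set fs" for fs :: "('v \<times> 'v) list"
    by (induction fs) (auto simp: Y_str_simps)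
  ultimately show ?thesis
    using endpoints by (auto simp: s1_def set_P_str)
qed

lemma set_A: "1 \<le> i \<Longrightarrow> set (A i) = set s1 \<union> case_prod HashL ` ({1..<i} \<times> {1..l})"
  by (rule set_alpha)

lemma HashL_notin_s1: "HashL i g \<notin> set s1"
  by (auto simp: set_s1)

lemma HashL_notin_A: "1 \<le> i \<Longrightarrow> HashL i g \<notin> set (A i)"
  by (auto simp: set_A HashL_notin_s1)

text \<open>Counts the phrase ends that first occurrences of symbols will force: 3n+3m symbols of
  vertices and edges, n+m separators of \<open>P_str\<close>, and \<open>l\<close> per
  level.\<close>

lemma card_set_s: "card (set s) = 4 * length vs + 4 * length es + l * (c - 1)"
proof -
  have s: "set s = Vert ` set vs \<union> (Vert' ` set vs \<union> (HashV ` set vs \<union> (Edge ` set es \<union> (Dollar ` set es \<union>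
      (HashE ` set es \<union> (HashP ` {1..length vs + length es} \<union> case_prod HashL ` ({1..<c} \<times> {1..l})))))))"
    unfolding s_eq set_A[OF c_pos] set_s1 by (simp add: Un_ac)
  have inj: "inj_on Vert S" "inj_on Vert' S" "inj_on HashV S" "inj_on Edge T" "inj_on Dollar T"
    "inj_on HashE T" "inj_on HashP U" "inj_on (case_prod HashL) W"
    for S :: "'v set" and T :: "('v \<times> 'v) set" and U W
    by (auto simp: inj_on_def)
  have disj: "f ` S \<inter> g ` T = {}" if "\<And>x y. f x \<noteq> g y"
    for f :: "'x \<Rightarrow> 'v symb" and g :: "'y \<Rightarrow> 'v symb" and S T
    using that by auto
  have card: "card (set vs) = length vs" "card (set es) = length es"
    using distinct by (simp_all add: distinct_card)
  show ?thesis
    unfolding s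
    by (simp add: card_Un_disjoint Int_Un_distrib disj card_image[OF inj(1)] card_image[OF inj(2)]
        card_image[OF inj(3)] card_image[OF inj(4)] card_image[OF inj(5)] card_image[OF inj(6)]
        card_image[OF inj(7)] card_image[OF inj(8)] card split: prod.split)
qed

lemma block_string_s1: "block_string (P_blocks \<union> X_blocks \<union> Y_blocks) s1"
  unfolding s1_def
  by (intro block_string_append block_string_mono[OF block_string_P] block_string_mono[OF block_string_X]
      block_string_mono[OF block_string_Y]) auto

lemma block_string_s: "block_string (P_blocks \<union> X_blocks \<union> Y_blocks \<union> L_blocks) s"
  unfolding s_eq
  by (intro block_string_alpha block_string_mono[OF block_string_s1]) auto

text \<open>Given the symbol at \<open>x\<close>, most of these cases and offsets are contradictory,
  so claims about neighbouring symbols become finite checks.\<close>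

lemma s_blocks:
  assumes "x < length s"
  obtains
    (P) v t q where "x = q \<or> x = q + 1" "q + 2 \<le> length s" "s ! q = Vert v" "s ! (q + 1) = HashP t"
  | (P') e t q where "x = q \<or> x = q + 1" "q + 2 \<le> length s" "s ! q = Edge e" "s ! (q + 1) = HashP t"
  | (X) v q where "x = q \<or> x = q + 1 \<or> x = q + 2" "q + 3 \<le> length s"
      "s ! q = Vert' v" "s ! (q + 1) = Vert v" "s ! (q + 2) = HashV v"
  | (Y) e q where "x = q \<or> x = q + 1 \<or> x = q + 2 \<or> x = q + 3 \<or> x = q + 4 \<or> x = q + 5 \<or> x = q + 6 \<or>
      x = q + 7 \<or> x = q + 8" "q + 9 \<le> length s"
      "s ! q = Vert' (fst e)" "s ! (q + 1) = Vert (fst e)" "s ! (q + 2) = Edge e" "s ! (q + 3) = Dollar e"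
      "s ! (q + 4) = Vert' (snd e)" "s ! (q + 5) = Vert (snd e)" "s ! (q + 6) = Edge e"
      "s ! (q + 7) = Dollar e" "s ! (q + 8) = HashE e"
  | (L) i g where "s ! x = HashL i g"
proof -
  obtain b q j where b: "b \<in> P_blocks \<union> X_blocks \<union> Y_blocks \<union> L_blocks" "j < length b" "x = q + j"
    "q + length b \<le> length s" "\<And>t. t < length b \<Longrightarrow> s ! (q + t) = b ! t"
    by (rule block_string_nth[OF block_string_s assms], rule that)
  from b(1) consider v t where "b = [Vert v, HashP t]" | e t where "b = [Edge e, HashP t]"
    | v where "b = X_block v" | e where "b = Y_block e" | i g where "b = [HashL i g]"
    by (auto simp: P_blocks_def X_blocks_def Y_blocks_def L_blocks_def)
  then show ?thesis
  proof cases
    case (1 v t)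
    have "x = q \<or> x = q + 1"
      using b(2) unfolding b(3) 1 by (auto simp: less_Suc_eq)
    moreover have "q + 2 \<le> length s" "s ! q = Vert v" "s ! (q + 1) = HashP t"
      using b(4) b(5)[of 0] b(5)[of 1] by (simp_all add: 1)
    ultimately show ?thesis
      by (rule P)
  next
    case (2 e t)
    have "x = q \<or> x = q + 1"
      using b(2) unfolding b(3) 2 by (auto simp: less_Suc_eq)
    moreover have "q + 2 \<le> length s" "s ! q = Edge e" "s ! (q + 1) = HashP t"
      using b(4) b(5)[of 0] b(5)[of 1] by (simp_all add: 2)
    ultimately show ?thesis
      by (rule P')
  next
    case (3 v)
    have "x = q \<or> x = q + 1 \<or> x = q + 2"
      using b(2) unfolding b(3) 3 by (auto simp: less_Suc_eq)
    moreover have "q + 3 \<le> length s" "s ! q = Vert' v" "s ! (q + 1) = Vert v" "s ! (q + 2) = HashV v"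
      using b(4) b(5)[of 0] b(5)[of 1] b(5)[of 2] by (simp_all add: 3)
    ultimately show ?thesis
      by (rule X)
  next
    case (4 e)
    have "x = q \<or> x = q + 1 \<or> x = q + 2 \<or> x = q + 3 \<or> x = q + 4 \<or> x = q + 5 \<or> x = q + 6 \<or>
        x = q + 7 \<or> x = q + 8"
      using b(2) unfolding b(3) 4 by (auto simp: less_Suc_eq)
    moreover have "q + 9 \<le> length s"
      using b(4) by (simp add: 4)
    moreover have "s ! q = Vert' (fst e)" "s ! (q + 1) = Vert (fst e)" "s ! (q + 2) = Edge e"
      "s ! (q + 3) = Dollar e" "s ! (q + 4) = Vert' (snd e)" "s ! (q + 5) = Vert (snd e)"
      "s ! (q + 6) = Edge e" "s ! (q + 7) = Dollar e" "s ! (q + 8) = HashE e"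
      using b(5)[of 0] b(5)[of 1] b(5)[of 2] b(5)[of 3] b(5)[of 4] b(5)[of 5]
        b(5)[of 6] b(5)[of 7] b(5)[of 8] by (simp_all add: 4)
    ultimately show ?thesis
      by (rule Y)
  next
    case (5 i g)
    then have "s ! x = HashL i g"
      using b(2,3) b(5)[of 0] by simp
    then show ?thesis
      by (rule L)
  qed
qed

lemma after_Vert':
  assumes "x < length s" "s ! x = Vert' v"
  shows "x + 2 < length s \<and> s ! (x + 1) = Vert v \<and> (s ! (x + 2) = HashV v \<or> (\<exists>e. s ! (x + 2) = Edge e))"
  using assms(1)
  by (cases x rule: s_blocks; (elim disjE)?; use assms(2) in \<open>simp add: numeral_eq_Suc\<close>)

lemma around_Edge_Dollar:
  assumes "x < length s" "s ! x = Edge e" "s ! (x + 1) = Dollar e'"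
  shows "x + 2 < length s \<and> 0 < x \<and>
    (s ! (x - 1) = Vert (fst e) \<and> s ! (x + 2) = Vert' (snd e) \<or>
     s ! (x - 1) = Vert (snd e) \<and> s ! (x + 2) = HashE e)"
  using assms(1)
  by (cases x rule: s_blocks; (elim disjE)?; use assms(2,3) in \<open>simp add: numeral_eq_Suc\<close>)

lemma after_Vert_Edge:
  assumes "x < length s" "s ! x = Vert v" "s ! (x + 1) = Edge e"
  shows "x + 2 < length s \<and> s ! (x + 2) = Dollar e"
  using assms(1)
  by (cases x rule: s_blocks; (elim disjE)?; use assms(2,3) in \<open>simp add: numeral_eq_Suc\<close>)

section \<open>First occurrences of symbols\<close>

definition first_pos :: "'v symb \<Rightarrow> nat" where
  "first_pos a = (LEAST x. x < length s \<and> s ! x = a)"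

lemma first_pos:
  assumes "a \<in> set s"
  shows "first_pos a < length s" "s ! first_pos a = a"
proof -
  obtain x where "x < length s \<and> s ! x = a"
    using assms by (auto simp: in_set_conv_nth)
  from LeastI[of "\<lambda>x. x < length s \<and> s ! x = a", OF this]
  show "first_pos a < length s" "s ! first_pos a = a"
    by (simp_all add: first_pos_def)
qed

lemma first_pos_le: "x < length s \<Longrightarrow> s ! x = a \<Longrightarrow> first_pos a \<le> x"
  unfolding first_pos_def by (rule Least_le) simp

lemma first_pos_prefix:
  assumes "s = u @ w" "a \<in> set u"
  shows "first_pos a < length u" "u ! first_pos a = a"
proof -
  obtain x where x: "x < length u" "u ! x = a"
    using assms(2) by (auto simp: in_set_conv_nth)
  then show "first_pos a < length u"
    using assms(1) first_pos_le[of x a] by (auto simp: nth_append)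
  then show "u ! first_pos a = a"
    using assms first_pos(2)[of a] by (auto simp: nth_append)
qed

text \<open>All these symbols occur in the prefix \<open>P_str\<close>, where each is followed by a
  separator. This tells their first occurrences apart from those in blocks of vertices and
  edges.\<close>

lemma after_first_Vert_or_Edge:
  assumes a: "a \<in> Vert ` set vs \<union> Edge ` set es"
  shows "\<exists>t. s ! (first_pos a + 1) = HashP t"
proof -
  define u where "u = P_str vs es"
  obtain w' where "s = s1 @ w'"
    using s1_prefix by blast
  then have "s = u @ (X_str vs @ Y_str es @ w')"
    by (simp add: s1_def u_def)
  then obtain w where w: "s = u @ w"
    by blast
  have "a \<in> set u"
    using a by (auto simp: set_P_str u_def)
  note f = first_pos_prefix[OF w this]
  obtain b q j where b: "b \<in> P_blocks" "j < length b" "first_pos a = q + j"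
    "q + length b \<le> length u" "\<And>t. t < length b \<Longrightarrow> u ! (q + t) = b ! t"
    by (rule block_string_nth[OF block_string_P[of vs es, folded u_def] f(1)], rule that)
  obtain z t where z: "b = [z, HashP t]"
    using b(1) by (auto simp: P_blocks_def)
  have "b ! j = a"
    using b(5)[OF b(2)] b(3) f(2) by simp
  moreover have "a \<noteq> HashP t"
    using a by auto
  ultimately have "j = 0"
    using b(2) z by (cases j) auto
  then have "first_pos a + 1 < length u" "u ! (first_pos a + 1) = HashP t"
    using b(3,4) b(5)[of 1] z by simp_all
  then show ?thesis
    unfolding w nth_append by auto
qed

text \<open>\<open>P_str\<close> has no symbol \<open>Vert' v\<close>, so the first one lies in
  \<open>X_str\<close>, before all edge gadgets.\<close>

lemma after_first_Vert':
  assumes v: "v \<in> set vs"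
  shows "s ! (first_pos (Vert' v) + 2) = HashV v"
proof -
  define u where "u = P_str vs es @ X_str vs"
  obtain w' where "s = s1 @ w'"
    using s1_prefix by blast
  then have "s = u @ (Y_str es @ w')"
    by (simp add: s1_def u_def)
  then obtain w where w: "s = u @ w"
    by blast
  have "Vert' v \<in> set u"
    using v by (auto simp: X_str_def u_def)
  note f = first_pos_prefix[OF w this]
  have bs: "block_string (P_blocks \<union> X_blocks) u"
    unfolding u_def
    by (intro block_string_append block_string_mono[OF block_string_P] block_string_mono[OF block_string_X]) auto
  obtain b q j where b: "b \<in> P_blocks \<union> X_blocks" "j < length b" "first_pos (Vert' v) = q + j"
    "q + length b \<le> length u" "\<And>t. t < length b \<Longrightarrow> u ! (q + t) = b ! t"
    by (rule block_string_nth[OF bs f(1)], rule that)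
  have b_j: "b ! j = Vert' v"
    using b(5)[OF b(2)] f(2) b(3) by simp
  from b(1) consider z t where "b = [z, HashP t]" "z \<noteq> Vert' v" | v' where "b = X_block v'"
    by (auto simp: P_blocks_def X_blocks_def)
  then have "j = 0 \<and> b = X_block v"
    using b(2) b_j by cases (auto simp: less_Suc_eq)
  then have "u ! (first_pos (Vert' v) + 2) = HashV v" "first_pos (Vert' v) + 2 < length u"
    using b(3,4) b(5)[of 2] by simp_all
  then show ?thesis
    unfolding w nth_append by simp
qed

text \<open>The second \<open>Dollar e\<close> of a gadget has the first one before it, so the first
  occurrence is at offset 3.\<close>

lemma after_first_Dollar:
  assumes e: "e \<in> set es"
  shows "s ! (first_pos (Dollar e) + 1) = Vert' (snd e)"
proof -
  have "Dollar e \<in> set s"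
    using e by (auto simp: s_eq set_A[OF c_pos] set_s1)
  note f = first_pos[OF this]
  show ?thesis
    using f(1)
  proof (cases rule: s_blocks)
    case (Y e' q)
    have "first_pos (Dollar e) = q + 3"
      using Y f(2) first_pos_le[of "q + 3" "Dollar e"] by auto
    then show ?thesis
      using Y f(2) by (auto simp: numeral_eq_Suc)
  qed (use f(2) in auto)
qed

text \<open>The end marker is \<open>HashE\<close> of the last edge for \<open>i = 1\<close>, and
  the separator \<open>HashL (i - 1) l\<close> otherwise; each occurs in \<open>A i\<close> only at
  the end.\<close>

lemma ends_aligned_s:
  assumes "es \<noteq> []" "1 \<le> i" "i \<le> c"
  shows "ends_aligned (A i) s" and "last (A i) \<notin> set (butlast (A i))" and "A i \<noteq> []"
proof -
  have "A i \<noteq> [] \<and> last (A i) \<notin> set (butlast (A i))"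
  proof (cases "i = 1")
    case True
    obtain fs e where es: "es = fs @ [e]"
      using assms(1) by (metis rev_exhaust)
    then have "e \<notin> set fs"
      using distinct(2) by simp
    then have "HashE e \<notin> set (Y_str fs)"
      by (induction fs) (auto simp: Y_str_simps)
    moreover have "HashE e \<notin> set (X_str vs)"
      by (auto simp: X_str_def)
    moreover have s1: "s1 = P_str vs es @ X_str vs @ Y_str fs @ Y_block e"
      unfolding s1_def by (simp add: es Y_str_simps)
    ultimately show ?thesis
      by (auto simp: True s1 butlast_append set_P_str)
  next
    case False
    then obtain j where j: "i = Suc j" "1 \<le> j"
      using assms(2) by (cases i) auto
    obtain m where m: "l = Suc m"
      using l_pos by (cases l) auto
    have "A i = (A j @ beta m j (A j) @ A j) @ [HashL j l]"
      using j by (simp add: alpha_Suc m beta_Suc)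
    moreover have "HashL j l \<notin> set (A j @ beta m j (A j) @ A j)"
      using HashL_notin_A[OF j(2)] by (auto simp: set_beta m)
    ultimately show ?thesis
      by (metis append_is_Nil_conv butlast_snoc last_snoc not_Cons_self2)
  qed
  then show "last (A i) \<notin> set (butlast (A i))" "A i \<noteq> []"
    by auto
  then show "ends_aligned (A i) s"
    unfolding s_eq using assms(2,3) HashL_notin_s1 by (intro ends_aligned_alpha) auto
qed

lemma Y_block_in_s1:
  assumes "e \<in> set es"
  obtains q where "q + 9 \<le> length s1" "\<And>t. t < 9 \<Longrightarrow> s1 ! (q + t) = Y_block e ! t"
proof -
  obtain fs gs where "es = fs @ e # gs"
    using split_list[OF assms] by blast
  then have "Y_str es = Y_str fs @ Y_block e @ Y_str gs"
    by (simp add: Y_str_simps)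
  then have s1: "s1 = (P_str vs es @ X_str vs @ Y_str fs) @ Y_block e @ Y_str gs"
    by (simp add: s1_def)
  define q where "q = length (P_str vs es @ X_str vs @ Y_str fs)"
  have "s1 ! (q + t) = Y_block e ! t" if "t < 9" for t
    unfolding s1 q_def nth_append_length_plus using that by (subst nth_append) simp
  moreover have "q + 9 \<le> length s1"
    unfolding s1 q_def by simp
  ultimately show ?thesis
    by (intro that[of q])
qed

end

section \<open>From parsings to vertex covers\<close>

locale gadget_parsing = gadget vs es c l
  for vs :: "'v list" and es :: "('v \<times> 'v) list" and c l :: nat +
  fixes ps :: "'v symb list list" and src :: "nat \<Rightarrow> nat" and k :: nat
  assumes blz: "blz_parsing c s ps src"
    and length_ps: "length ps = 4 * length vs + 6 * length es + k + l * (c - 1)"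
    and k_less: "k < l"
begin

abbreviation E :: "nat \<Rightarrow> bool" where
  "E \<equiv> last_of_phrase ps"

abbreviation hp :: "nat \<Rightarrow> nat" where
  "hp \<equiv> hop ps src"

lemma lz: "lz_parsing s ps src"
  using blz by (simp add: blz_parsing_def)

lemma parsing_ps: "parsing s ps"
  using lz by (simp add: lz_parsing_def)

lemma E_less: "E x \<Longrightarrow> x < length s"
  by (rule last_of_phrase_less[OF parsing_ps])

lemma hp_pos: "x < length s \<Longrightarrow> \<not> E x \<Longrightarrow> 1 \<le> hp x"
  using hop_copy[OF lz] by simp

section \<open>Phrase ends forced in every parsing\<close>

lemma E_first_pos:
  assumes "a \<in> set s"
  shows "E (first_pos a)"
proof (rule ccontr)
  assume ne: "\<not> E (first_pos a)"
  note f = first_pos[OF assms]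
  \<comment> \<open>A position that is not an end repeats the symbol \<open>d\<close> places to its
    left, which a first occurrence cannot do.\<close>
  obtain b d where d: "0 < d" "d \<le> b" "b \<le> first_pos a"
    "\<And>y. b \<le> y \<Longrightarrow> y \<le> first_pos a \<Longrightarrow> s ! y = s ! (y - d)"
    using copy_phrase[OF lz f(1) ne] by metis
  then have "s ! (first_pos a - d) = a"
    using f by simp
  then have "first_pos a \<le> first_pos a - d"
    using f by (intro first_pos_le) auto
  then show False
    using d by simp
qed

definition pairs :: "('v \<times> 'v \<times> 'v) set" where
  "pairs = (\<lambda>e. (fst e, e)) ` set es \<union> (\<lambda>e. (snd e, e)) ` set es"

definition pair_pos :: "'v \<Rightarrow> 'v \<times> 'v \<Rightarrow> nat" where
  "pair_pos v e = (LEAST x. x + 1 < length s \<and> s ! x = Vert v \<and> s ! (x + 1) = Edge e)"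

lemma card_pairs: "card pairs = 2 * length es"
proof -
  have "(\<lambda>e. (fst e, e)) ` set es \<inter> (\<lambda>e. (snd e, e)) ` set es = {}"
    using endpoints by auto
  moreover have "card ((\<lambda>e. (f e, e)) ` set es) = length es" for f :: "'v \<times> 'v \<Rightarrow> 'v"
    using distinct(2) by (simp add: card_image inj_on_def distinct_card)
  ultimately show ?thesis
    by (simp add: pairs_def card_Un_disjoint)
qed

text \<open>The gadget of \<open>e\<close> inside \<open>s1\<close> contains the pair. That its
  first occurrence lies in \<open>s1\<close> later excludes such forced ends from further
  copies.\<close>

lemma pair_pos:
  assumes "(v, e) \<in> pairs"
  shows "pair_pos v e + 1 < length s1" "s ! pair_pos v e = Vert v" "s ! (pair_pos v e + 1) = Edge e"
proof -
  have e: "e \<in> set es" and v: "v = fst e \<or> v = snd e"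
    using assms by (auto simp: pairs_def)
  obtain q where q: "q + 9 \<le> length s1" "\<And>t. t < 9 \<Longrightarrow> s1 ! (q + t) = Y_block e ! t"
    using Y_block_in_s1[OF e] by metis
  have nth: "s1 ! (q + 1) = Vert (fst e)" "s1 ! (q + 2) = Edge e"
    "s1 ! (q + 5) = Vert (snd e)" "s1 ! (q + 6) = Edge e"
    using q(2)[of 1] q(2)[of 2] q(2)[of 5] q(2)[of 6] by simp_all
  obtain w where w: "s = s1 @ w"
    using s1_prefix by blast
  have ex: "\<exists>x. x + 1 < length s1 \<and> s ! x = Vert v \<and> s ! (x + 1) = Edge e"
    using v
  proof
    assume "v = fst e"
    then show ?thesis
      using nth q(1) w by (intro exI[of _ "q + 1"]) (simp add: nth_append ac_simps)
  next
    assume "v = snd e"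
    then show ?thesis
      using nth q(1) w by (intro exI[of _ "q + 5"]) (simp add: nth_append ac_simps)
  qed
  then obtain x where x: "x + 1 < length s1" "s ! x = Vert v" "s ! (x + 1) = Edge e"
    by blast
  then have P: "x + 1 < length s \<and> s ! x = Vert v \<and> s ! (x + 1) = Edge e"
    by (simp add: w)
  from LeastI[of "\<lambda>x. x + 1 < length s \<and> s ! x = Vert v \<and> s ! (x + 1) = Edge e", OF P]
  show "s ! pair_pos v e = Vert v" "s ! (pair_pos v e + 1) = Edge e"
    by (simp_all add: pair_pos_def)
  from Least_le[of "\<lambda>x. x + 1 < length s \<and> s ! x = Vert v \<and> s ! (x + 1) = Edge e", OF P]
  show "pair_pos v e + 1 < length s1"
    using x(1) by (simp add: pair_pos_def)
qed

lemma length_s1: "length s1 \<le> length s"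
  using s1_prefix by auto

text \<open>If both positions of the pair end a phrase, the first is taken, so that each pair
  accounts for exactly one end.\<close>

definition pair_end :: "'v \<times> 'v \<times> 'v \<Rightarrow> nat" where
  "pair_end = (\<lambda>(v, e). if E (pair_pos v e) then pair_pos v e else pair_pos v e + 1)"

text \<open>The first occurrence of a pair of symbols is not part of a copied string.\<close>
lemma E_pair_end:
  assumes "(v, e) \<in> pairs"
  shows "E (pair_end (v, e))"
proof (rule ccontr)
  let ?x = "pair_pos v e"
  assume "\<not> E (pair_end (v, e))"
  then have ne: "\<not> E ?x" "\<not> E (?x + 1)"
    by (auto simp: pair_end_def split: if_splits)
  note p = pair_pos[OF assms]
  have len: "?x + 1 < length s"
    using p(1) length_s1 by simp
  obtain b d where d: "0 < d" "d \<le> b" "b \<le> ?x + 1" "E (b - 1)"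
    "\<And>y. b \<le> y \<Longrightarrow> y \<le> ?x + 1 \<Longrightarrow> s ! y = s ! (y - d)"
    using copy_phrase[OF lz len ne(2)] by metis
  \<comment> \<open>A phrase starting between the two symbols would make the first an end. So both
    lie in one phrase and are shifted by the same \<open>d\<close>.\<close>
  have "b \<le> ?x"
    using d(2-4) ne(1) by (metis Suc_eq_plus1 diff_Suc_1 le_Suc_eq)
  then have "s ! (?x - d) = Vert v" "s ! (?x - d + 1) = Edge e"
    using d(5)[of ?x] d(5)[of "?x + 1"] d(1-3) p by (simp_all add: Suc_diff_le)
  then have "?x \<le> ?x - d"
    using len unfolding pair_pos_def[of v e] by (intro Least_le) (auto simp: pair_pos_def)
  then show False
    using d(1,2) \<open>b \<le> ?x\<close> by simp
qed

text \<open>The symbols around the end determine the pair, whence injectivity; the symbol behind it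
  excludes positions in \<open>P_str\<close>.\<close>

lemma pair_end_cases:
  assumes "(v, e) \<in> pairs"
  obtains "pair_end (v, e) = pair_pos v e" "s ! pair_end (v, e) = Vert v" "s ! (pair_end (v, e) + 1) = Edge e"
  | "pair_end (v, e) = pair_pos v e + 1" "s ! pair_end (v, e) = Edge e"
    "s ! (pair_end (v, e) - 1) = Vert v" "s ! (pair_end (v, e) + 1) = Dollar e"
proof -
  note p = pair_pos[OF assms]
  have "s ! (pair_pos v e + 2) = Dollar e"
    using after_Vert_Edge[OF _ p(2,3)] p(1) length_s1 by simp
  then show ?thesis
    using p that by (cases "E (pair_pos v e)") (auto simp: pair_end_def)
qed

text \<open>Depends on the parsing only through the choice made in \<open>pair_end\<close>.\<close>

definition mandatory :: "nat set" where
  "mandatory = first_pos ` set s \<union> pair_end ` pairs"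

lemma mandatory_cases:
  assumes "x \<in> mandatory"
  obtains "x = first_pos (s ! x)" "s ! x \<in> set s"
  | v e where "(v, e) \<in> pairs" "x = pair_end (v, e)"
  using assms first_pos unfolding mandatory_def by fastforce

lemma Vert_in_s: "Vert v \<in> set s \<Longrightarrow> v \<in> set vs"
  and Vert'_in_s: "Vert' v \<in> set s \<Longrightarrow> v \<in> set vs"
  and Edge_in_s: "Edge e \<in> set s \<Longrightarrow> e \<in> set es"
  and Dollar_in_s: "Dollar e \<in> set s \<Longrightarrow> e \<in> set es"
  by (auto simp: s_eq set_A[OF c_pos] set_s1)

lemma inj_pair_end: "inj_on pair_end pairs"
proof (rule inj_onI, clarify)
  fix v e v' e'
  assume m: "(v, e) \<in> pairs" "(v', e') \<in> pairs" and eq: "pair_end (v, e) = pair_end (v', e')"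
  show "v = v' \<and> e = e'"
    by (rule pair_end_cases[OF m(1)]; rule pair_end_cases[OF m(2)]) (use eq in auto)
qed

text \<open>The first occurrence of a vertex or edge symbol is followed by a \<open>HashP\<close>
  separator, a pair end by \<open>Edge e\<close> or \<open>Dollar e\<close>.\<close>

lemma first_pos_not_pair_end:
  assumes "a \<in> set s" "(v, e) \<in> pairs"
  shows "first_pos a \<noteq> pair_end (v, e)"
proof
  assume eq: "first_pos a = pair_end (v, e)"
  note f = first_pos(2)[OF assms(1)]
  show False
    using assms(2)
  proof (cases rule: pair_end_cases)
    case 1
    then have "a = Vert v" "v \<in> set vs"
      using eq f assms(1) Vert_in_s by auto
    then show False
      using after_first_Vert_or_Edge[of a] 1(3) eq by auto
  next
    case 2
    then have "a = Edge e" "e \<in> set es"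
      using eq f assms(1) Edge_in_s by auto
    then show False
      using after_first_Vert_or_Edge[of a] 2(4) eq by auto
  qed
qed

lemma card_mandatory: "card mandatory = 4 * length vs + 6 * length es + l * (c - 1)"
proof -
  have "inj_on first_pos (set s)"
    by (metis first_pos(2) inj_on_def)
  moreover have "first_pos ` set s \<inter> pair_end ` pairs = {}"
    using first_pos_not_pair_end by fastforce
  moreover have "finite pairs"
    by (simp add: pairs_def)
  ultimately show ?thesis
    by (simp add: mandatory_def card_Un_disjoint card_image inj_pair_end card_pairs card_set_s)
qed

section \<open>Extra ends and the vertices charged for them\<close>

definition extra :: "nat set" where
  "extra = {x. E x} - mandatory"

lemma finite_ends: "finite {x. E x}"
  using ends_eq[OF parsing_ps] by simp

lemma finite_extra: "finite extra"
  by (simp add: extra_def finite_ends)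

lemma card_extra: "card extra = k"
proof -
  have "mandatory \<subseteq> {x. E x}"
    using E_first_pos E_pair_end by (auto simp: mandatory_def)
  then have "card extra = card {x. E x} - card mandatory"
    unfolding extra_def using finite_ends by (intro card_Diff_subset) (auto intro: finite_subset)
  then show ?thesis
    by (simp add: card_ends[OF parsing_ps] length_ps card_mandatory)
qed

text \<open>Reads only nearby symbols, so all copies of a gadget are treated alike. In a gadget, the
  symbol two places after \<open>Edge e\<close> tells which half this is, hence which endpoint
  stands in front. For \<open>Dollar e\<close>, only ends in the second half will matter, hence
  \<open>snd e\<close>.\<close>

definition charged :: "nat \<Rightarrow> 'v" where
  "charged x = (case s ! x of
     Vert v \<Rightarrow> v
   | Vert' v \<Rightarrow> v
   | Edge e \<Rightarrow> if s ! (x + 2) = Vert' (snd e) then fst e else snd e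
   | Dollar e \<Rightarrow> snd e
   | _ \<Rightarrow> undefined)"

text \<open>The source of all the following restrictions: where the charged vertex is not hit by any
  extra end, an end must be mandatory, and mandatory ends have known neighbours.\<close>

lemma mandatoryI: "charged x \<notin> charged ` extra \<Longrightarrow> E x \<Longrightarrow> x \<in> mandatory"
  by (auto simp: extra_def)

lemma uncharged_HashV:
  assumes "v \<notin> charged ` extra" "E x" "s ! x = Vert v"
  shows "s ! (x + 1) \<noteq> HashV v"
proof
  assume h: "s ! (x + 1) = HashV v"
  have "charged x = v"
    using assms(3) by (simp add: charged_def)
  then have "x \<in> mandatory"
    using assms by (intro mandatoryI) simp_all
  then show False
  proof (cases rule: mandatory_cases)
    case 1
    then show False
      using after_first_Vert_or_Edge[of "Vert v"] assms(3) h Vert_in_s by auto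
  next
    case (2 v' e)
    show False
      using 2(1) by (cases rule: pair_end_cases) (use 2(2) assms(3) h in auto)
  qed
qed

lemma uncharged_Vert':
  assumes "v \<notin> charged ` extra" "E x" "s ! x = Vert' v"
  shows "s ! (x + 2) = HashV v"
proof -
  have "charged x = v"
    using assms(3) by (simp add: charged_def)
  then have "x \<in> mandatory"
    using assms by (intro mandatoryI) simp_all
  then show ?thesis
  proof (cases rule: mandatory_cases)
    case 1
    then show ?thesis
      using after_first_Vert'[of v] assms(3) Vert'_in_s by auto
  next
    case (2 v' e)
    show ?thesis
      using 2(1) by (cases rule: pair_end_cases) (use 2(2) assms(3) in auto)
  qed
qed

lemma uncharged_Dollar:
  assumes "snd e \<notin> charged ` extra" "E x" "s ! x = Dollar e"
  shows "s ! (x + 1) \<noteq> HashE e"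
proof
  assume h: "s ! (x + 1) = HashE e"
  have "charged x = snd e"
    using assms(3) by (simp add: charged_def)
  then have "x \<in> mandatory"
    using assms by (intro mandatoryI) simp_all
  then show False
  proof (cases rule: mandatory_cases)
    case 1
    then show False
      using after_first_Dollar[of e] assms(3) h Dollar_in_s by auto
  next
    case (2 v' e)
    show False
      using 2(1) by (cases rule: pair_end_cases) (use 2(2) assms(3) in auto)
  qed
qed

text \<open>A first occurrence of \<open>Vert v\<close> would be followed by \<open>HashP\<close>,
  so this end is the one assigned to the pair \<open>(v, e)\<close>.\<close>

lemma uncharged_Vert:
  assumes "v \<notin> charged ` extra" "E x" "s ! x = Vert v" "s ! (x + 1) = Edge e"
  shows "x = pair_end (v, e) \<and> x = pair_pos v e"
proof -
  have "charged x = v"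
    using assms(3) by (simp add: charged_def)
  then have "x \<in> mandatory"
    using assms by (intro mandatoryI) simp_all
  then show "x = pair_end (v, e) \<and> x = pair_pos v e"
  proof (cases rule: mandatory_cases)
    case 1
    then have "\<exists>t. s ! (x + 1) = HashP t"
      using after_first_Vert_or_Edge[of "Vert v"] assms(3) Vert_in_s by auto
    then show "x = pair_end (v, e) \<and> x = pair_pos v e"
      using assms(4) by auto
  next
    case (2 v' e')
    have "v' = v \<and> e' = e \<and> pair_end (v, e) = pair_pos v e"
      using 2(1) by (cases rule: pair_end_cases) (use 2(2) assms(3,4) in auto)
    then show "x = pair_end (v, e) \<and> x = pair_pos v e"
      using 2 by auto
  qed
qed

text \<open>By \<open>around_Edge_Dollar\<close> the test on \<open>x + 2\<close> finds exactly the
  vertex in front of \<open>Edge e\<close>, so a mandatory end here is the one assigned to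
  \<open>(v, e)\<close>, at its second symbol.\<close>

lemma uncharged_Edge:
  assumes e: "fst e \<noteq> snd e" and "E x" "s ! x = Edge e" "s ! (x + 1) = Dollar e"
    and v: "v = (if s ! (x + 2) = Vert' (snd e) then fst e else snd e)" "v \<notin> charged ` extra"
  shows "pair_end (v, e) = pair_pos v e + 1"
proof -
  have "charged x = v"
    using assms by (simp add: charged_def)
  then have "x \<in> mandatory"
    using assms by (intro mandatoryI) simp_all
  then show ?thesis
  proof (cases rule: mandatory_cases)
    case 1
    then have "\<exists>t. s ! (x + 1) = HashP t"
      using after_first_Vert_or_Edge[of "Edge e"] assms(3) Edge_in_s by auto
    then show ?thesis
      using assms(4) by auto
  next
    case (2 v' e')
    have "e' = e \<and> s ! (x - 1) = Vert v' \<and> pair_end (v', e') = pair_pos v' e' + 1"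
      using 2(1) by (cases rule: pair_end_cases) (use 2(2) assms(3) in auto)
    then show ?thesis
      using around_Edge_Dollar[of x e e] E_less assms by auto
  qed
qed

section \<open>Hop-numbers above 1 in an uncharged gadget\<close>

text \<open>If the source \<open>w\<close> of \<open>Vert' v\<close> lies before the phrase and is
  not an end, the copy has hop-number at least 2. If \<open>w\<close> is an end, it is followed by
  \<open>v #\<close>, and there \<open>v\<close> cannot be an end; so the copy of
  \<open>Vert v\<close> has hop-number at least 2. Sources inside the phrase are handled by
  induction.\<close>

lemma Vert'_Vert_deep:
  assumes v: "v \<notin> charged ` extra"
  shows "y + 1 < length s \<Longrightarrow> s ! y = Vert' v \<Longrightarrow> \<not> E y \<Longrightarrow> \<not> E (y + 1) \<Longrightarrow> 1 < hp y \<or> 1 < hp (y + 1)"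
proof (induction y rule: less_induct)
  case (less y)
  obtain b d where d: "0 < d" "d \<le> b" "b \<le> y + 1" "E (b - 1)"
    and copy: "\<And>x. b \<le> x \<Longrightarrow> x \<le> y + 1 \<Longrightarrow> \<not> E x"
      "\<And>x. b \<le> x \<Longrightarrow> x \<le> y + 1 \<Longrightarrow> s ! x = s ! (x - d)"
      "\<And>x. b \<le> x \<Longrightarrow> x \<le> y + 1 \<Longrightarrow> hp x = hp (x - d) + (if x < b + d then 1 else 0)"
    by (rule copy_phrase[OF lz less.prems(1,4)], rule that)
  have "b \<noteq> y + 1"
    using d(4) less.prems(3) by auto
  then have b_le: "b \<le> y"
    using d(3) by simp
  define w where "w = y - d"
  have w: "y = w + d" "w < y"
    using b_le d(1,2) by (auto simp: w_def)
  have sw: "s ! w = Vert' v"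
    using copy(2)[of y] b_le less.prems(2) w(1) by simp
  have sw1: "s ! (w + 1) = Vert v"
    using after_Vert'[of w v] sw less.prems(1) w(2) by simp
  show ?case
  proof (cases "b \<le> w")
    case True
    then have "hp y = hp w" "hp (y + 1) = hp (w + 1)" "\<not> E w" "\<not> E (w + 1)"
      using copy(1)[of w] copy(1)[of "w + 1"] copy(3)[of y] copy(3)[of "y + 1"] w by auto
    then show ?thesis
      using less.IH[of w] sw w less.prems(1) by auto
  next
    case False
    then have hy: "hp y = hp w + 1"
      using copy(3)[of y] b_le w(1) by simp
    show ?thesis
    proof (cases "E w")
      case False
      then show ?thesis
        using hp_pos[of w] hy w(2) less.prems(1) by simp
    next
      case True
      have sw2: "s ! (w + 2) = HashV v"
        by (rule uncharged_Vert'[OF v True sw])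
      show ?thesis
      proof (cases "w + 1 < b")
        case True
        have "\<not> E (w + 1)"
          using uncharged_HashV[OF v, of "w + 1"] sw1 sw2 by auto
        then have "1 \<le> hp (w + 1)"
          using hp_pos[of "w + 1"] w(2) less.prems(1) by simp
        then show ?thesis
          using copy(3)[of "y + 1"] True b_le w(1) by simp
      next
        \<comment> \<open>The phrase starts exactly between the two source symbols, so
          \<open>y + 1 = b + d\<close> has the hop-number of \<open>b\<close>. The source
          \<open>b - d\<close> of \<open>b\<close> again carries \<open>v #\<close>, hence is no
          end.\<close>
        case False
        with \<open>\<not> b \<le> w\<close> have b: "w + 1 = b"
          by simp
        have "hp (y + 1) = hp b"
          using copy(3)[of "y + 1"] b w(1) by simp
        also have "\<dots> = hp (b - d) + 1"
          using copy(3)[of b] b w d(1) by simp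
        finally have hb: "hp (y + 1) = hp (b - d) + 1" .
        have "s ! (b - d) = Vert v"
          using copy(2)[of b] b w sw1 by simp
        moreover have "s ! (b - d + 1) = HashV v"
          using copy(2)[of "b + 1"] b w sw2 d(1,2) by (simp add: Suc_diff_le numeral_eq_Suc)
        ultimately have "\<not> E (b - d)"
          using uncharged_HashV[OF v, of "b - d"] by auto
        then have "1 \<le> hp (b - d)"
          using hp_pos[of "b - d"] b w less.prems(1) by simp
        then show ?thesis
          using hb by simp
      qed
    qed
  qed
qed

text \<open>With no end between the two symbols, a phrase copying \<open>Dollar e\<close> also
  copies the \<open>Edge e\<close> before it, and the source \<open>Edge e\<close> is no end
  either.\<close>

lemma Edge_Dollar_deep:
  assumes no_end: "\<And>x. s ! x = Edge e \<Longrightarrow> s ! (x + 1) = Dollar e \<Longrightarrow> \<not> E x"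
  shows "y + 1 < length s \<Longrightarrow> s ! y = Edge e \<Longrightarrow> s ! (y + 1) = Dollar e \<Longrightarrow> \<not> E (y + 1) \<Longrightarrow> 1 < hp y"
proof (induction y rule: less_induct)
  case (less y)
  obtain b d where d: "0 < d" "d \<le> b" "b \<le> y + 1" "E (b - 1)"
    and copy: "\<And>x. b \<le> x \<Longrightarrow> x \<le> y + 1 \<Longrightarrow> \<not> E x"
      "\<And>x. b \<le> x \<Longrightarrow> x \<le> y + 1 \<Longrightarrow> s ! x = s ! (x - d)"
      "\<And>x. b \<le> x \<Longrightarrow> x \<le> y + 1 \<Longrightarrow> hp x = hp (x - d) + (if x < b + d then 1 else 0)"
    by (rule copy_phrase[OF lz less.prems(1,4)], rule that)
  have "b \<noteq> y + 1"
    using d(4) no_end[OF less.prems(2,3)] by auto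
  then have b_le: "b \<le> y"
    using d(3) by simp
  define w where "w = y - d"
  have w: "y = w + d" "w < y"
    using b_le d(1,2) by (auto simp: w_def)
  have sw: "s ! w = Edge e" "s ! (w + 1) = Dollar e"
    using copy(2)[of y] copy(2)[of "y + 1"] b_le less.prems(2,3) w(1) by simp_all
  show ?case
  proof (cases "b \<le> w")
    case True
    then have "hp y = hp w" "\<not> E (w + 1)"
      using copy(1)[of "w + 1"] copy(3)[of y] w by auto
    then show ?thesis
      using less.IH[of w] sw w less.prems(1) by auto
  next
    case False
    then have "hp y = hp w + 1"
      using copy(3)[of y] b_le w(1) by simp
    then show ?thesis
      using hp_pos[of w] no_end[OF sw] w(2) less.prems(1) by simp
  qed
qed

section \<open>Raising the bound from level to level\<close>

definition occ :: "nat \<Rightarrow> nat \<Rightarrow> bool" where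
  "occ i x \<longleftrightarrow> x + length (A i) \<le> length s \<and> (\<forall>t<length (A i). s ! (x + t) = A i ! t)"

text \<open>
  A copy may take the two symbols at \<open>z\<close> from different occurrences, so neither of the two hop-numbers
  alone can be bounded in all occurrences. That no phrase ends between them keeps them together.
\<close>
definition deep :: "nat \<Rightarrow> nat \<Rightarrow> bool" where
  "deep i z \<longleftrightarrow> z + 1 < length (A i) \<and>
    (\<forall>x. occ i x \<longrightarrow> \<not> E (x + z) \<and> (i < hp (x + z) \<or> i < hp (x + z + 1)))"

text \<open>If the forced end of a pair \<open>(v, e)\<close> is not at \<open>Vert v\<close>, no
  occurrence of \<open>v e\<close> has an end at \<open>v\<close>, and \<open>v' v\<close> in that
  half of the gadget works (offset 0 or 4). If both forced ends are at the vertices, no end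
  separates \<open>e $\<close>, and the second \<open>e $\<close> works (offset 6), since
  \<open>Dollar e\<close> before \<open>HashE e\<close> is no end.\<close>

lemma deep_base:
  assumes e: "e \<in> set es" and unc: "fst e \<notin> charged ` extra" "snd e \<notin> charged ` extra"
  shows "\<exists>z. deep 1 z"
proof -
  obtain q where q: "q + 9 \<le> length s1" "\<And>t. t < 9 \<Longrightarrow> s1 ! (q + t) = Y_block e ! t"
    by (rule Y_block_in_s1[OF e], rule that)
  have occ: "x + q + 9 \<le> length s \<and> s ! (x + q) = Vert' (fst e) \<and> s ! (x + q + 1) = Vert (fst e) \<and>
      s ! (x + q + 2) = Edge e \<and> s ! (x + q + 4) = Vert' (snd e) \<and> s ! (x + q + 5) = Vert (snd e) \<and>
      s ! (x + q + 6) = Edge e \<and> s ! (x + q + 7) = Dollar e \<and> s ! (x + q + 8) = HashE e"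
    if "occ 1 x" for x
  proof -
    have "s ! (x + q + t) = Y_block e ! t" if t: "t < 9" for t
      using \<open>occ 1 x\<close> q(1) q(2)[OF t] t by (auto simp: occ_def add.assoc)
    from this[of 0] this[of 1] this[of 2] this[of 4] this[of 5] this[of 6] this[of 7] this[of 8]
    show ?thesis
      using \<open>occ 1 x\<close> q(1) by (simp add: occ_def)
  qed
  have ne: "fst e \<noteq> snd e"
    using endpoints[OF e] by simp
  consider (fst) "pair_end (fst e, e) \<noteq> pair_pos (fst e) e" | (snd) "pair_end (snd e, e) \<noteq> pair_pos (snd e) e"
    | (none) "pair_end (fst e, e) = pair_pos (fst e) e" "pair_end (snd e, e) = pair_pos (snd e) e"
    by blast
  then show ?thesis
  proof cases
    case fst
    have "deep 1 q"
      unfolding deep_def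
    proof (intro conjI allI impI)
      fix x assume x: "occ 1 x"
      note o = occ[OF x]
      show 1: "\<not> E (x + q)"
        using uncharged_Vert'[OF unc(1), of "x + q"] o by auto
      have "\<not> E (x + q + 1)"
        using uncharged_Vert[OF unc(1), of "x + q + 1" e] o fst by (auto simp: numeral_eq_Suc)
      then show "1 < hp (x + q) \<or> 1 < hp (x + q + 1)"
        using o 1 by (intro Vert'_Vert_deep[OF unc(1)]) auto
    qed (use q(1) in simp)
    then show ?thesis ..
  next
    case snd
    have "deep 1 (q + 4)"
      unfolding deep_def
    proof (intro conjI allI impI)
      fix x assume x: "occ 1 x"
      note o = occ[OF x]
      show 1: "\<not> E (x + (q + 4))"
        using uncharged_Vert'[OF unc(2), of "x + q + 4"] o by (auto simp: ac_simps)
      have "\<not> E (x + (q + 4) + 1)"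
        using uncharged_Vert[OF unc(2), of "x + q + 5" e] o snd by (auto simp: ac_simps)
      then show "1 < hp (x + (q + 4)) \<or> 1 < hp (x + (q + 4) + 1)"
        using o 1 by (intro Vert'_Vert_deep[OF unc(2)]) (auto simp: ac_simps)
    qed (use q(1) in simp)
    then show ?thesis ..
  next
    case none
    have no_end: "\<not> E x" if "s ! x = Edge e" "s ! (x + 1) = Dollar e" for x
      using uncharged_Edge[OF ne _ that refl] unc none by (cases "s ! (x + 2) = Vert' (snd e)") auto
    have "deep 1 (q + 6)"
      unfolding deep_def
    proof (intro conjI allI impI)
      fix x assume x: "occ 1 x"
      note o = occ[OF x]
      show "\<not> E (x + (q + 6))"
        using no_end[of "x + q + 6"] o by (auto simp: ac_simps)
      have "\<not> E (x + (q + 6) + 1)"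
        using uncharged_Dollar[OF unc(2), of "x + q + 7"] o by (auto simp: ac_simps)
      then have "1 < hp (x + (q + 6))"
        using o by (intro Edge_Dollar_deep[OF no_end]) (auto simp: ac_simps)
      then show "1 < hp (x + (q + 6)) \<or> 1 < hp (x + (q + 6) + 1)" ..
    qed (use q(1) in simp)
    then show ?thesis ..
  qed
qed

text \<open>First occurrences of symbols of \<open>A i\<close> lie in the prefix \<open>A i\<close>
  of \<open>s\<close>, and those of pairs even in \<open>s1\<close>. Hence ends in later copies of
  \<open>A i\<close> are extra.\<close>

lemma mandatory_less:
  assumes "x \<in> mandatory" "1 \<le> i" "i \<le> c" "s ! x \<in> set (A i)"
  shows "x < length (A i)"
  using assms(1)
proof (cases rule: mandatory_cases)
  case 1
  obtain w where "s = A i @ w"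
    using A_prefix[OF assms(2,3)] by blast
  then show ?thesis
    using first_pos_prefix(1)[of "A i" w "s ! x"] assms(4) 1(1) by simp
next
  case (2 v e)
  obtain w where "A i = s1 @ w"
    using alpha_prefix[of 1 i s1 l] assms(2) by auto
  moreover have "pair_end (v, e) < length s1"
    using pair_pos(1)[OF 2(1)] by (simp add: pair_end_def)
  ultimately show ?thesis
    using 2(2) by simp
qed

text \<open>Pigeonhole: otherwise each of the \<open>l\<close> separators of level \<open>i\<close>
  would have an end in some \<open>A i\<close> in front of it, which gives \<open>l\<close>
  different extra ends, while there are only \<open>k < l\<close>.\<close>

lemma untouched_copy:
  assumes i: "1 \<le> i" "i < c"
  obtains g where "1 \<le> g" "g \<le> l"
    "\<And>x t. occ i x \<Longrightarrow> s ! (x + length (A i)) = HashL i g \<Longrightarrow> t < length (A i) \<Longrightarrow> \<not> E (x + t)"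
proof -
  let ?r = "length (A i)"
  have "\<exists>g\<in>{1..l}. \<forall>x t. occ i x \<longrightarrow> s ! (x + ?r) = HashL i g \<longrightarrow> t < ?r \<longrightarrow> \<not> E (x + t)"
  proof (rule ccontr)
    assume "\<not> ?thesis"
    then have "\<forall>g\<in>{1..l}. \<exists>x t. occ i x \<and> s ! (x + ?r) = HashL i g \<and> t < ?r \<and> E (x + t)"
      by blast
    then obtain X T where XT: "\<And>g. g \<in> {1..l} \<Longrightarrow> occ i (X g)"
      "\<And>g. g \<in> {1..l} \<Longrightarrow> s ! (X g + ?r) = HashL i g" "\<And>g. g \<in> {1..l} \<Longrightarrow> T g < ?r"
      "\<And>g. g \<in> {1..l} \<Longrightarrow> E (X g + T g)"
      by metis
    \<comment> \<open>Two such occurrences sharing a position but starting at different places would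
      put the separator behind the earlier one inside the later one.\<close>
    have le: "X g \<le> X h" if "g \<in> {1..l}" "h \<in> {1..l}" "X g + T g = X h + T h" for g h
    proof (rule ccontr)
      assume "\<not> X g \<le> X h"
      define t where "t = X h + ?r - X g"
      have "X g + T g < X h + ?r"
        using that(3) XT(3)[OF that(2)] by linarith
      then have t: "X g + t = X h + ?r" "t < ?r"
        using \<open>\<not> X g \<le> X h\<close> unfolding t_def by linarith+
      have "s ! (X g + t) = A i ! t"
        using XT(1)[OF that(1)] t(2) by (simp add: occ_def)
      then have "HashL i h = A i ! t"
        using XT(2)[OF that(2)] t(1) by simp
      then have "HashL i h \<in> set (A i)"
        using t(2) by simp
      then show False
        using HashL_notin_A[OF i(1)] by simp
    qed
    have "inj_on (\<lambda>g. X g + T g) {1..l}"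
    proof (rule inj_onI)
      fix g h assume gh: "g \<in> {1..l}" "h \<in> {1..l}" "X g + T g = X h + T h"
      then have "X g = X h"
        using le[of g h] le[of h g] by simp
      then have "HashL i g = s ! (X h + ?r)"
        using XT(2)[OF gh(1)] by simp
      also have "\<dots> = HashL i h"
        by (rule XT(2)[OF gh(2)])
      finally show "g = h"
        by simp
    qed
    moreover have "X g + T g \<in> extra" if g: "g \<in> {1..l}" for g
    proof (rule ccontr)
      assume "X g + T g \<notin> extra"
      then have m: "X g + T g \<in> mandatory"
        using XT(4)[OF g] by (simp add: extra_def)
      have "s ! (X g + T g) \<in> set (A i)"
        using XT(1,3)[OF g] by (simp add: occ_def)
      then have lt: "X g + T g < ?r"
        using mandatory_less[OF m] i by simp
      \<comment> \<open>As \<open>s\<close> begins with two copies of \<open>A i\<close>, an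
        occurrence starting in the first is followed by a symbol of the second, not by a separator
        of level \<open>i\<close>.\<close>
      obtain w where w: "s = A (Suc i) @ w"
        using A_prefix[of "Suc i"] i(2) by auto
      obtain v where "beta l i (A i) = A i @ v"
        using beta_prefix[OF l_pos] by blast
      then have "s = A i @ A i @ (v @ w)"
        using w i(1) by (simp add: alpha_Suc)
      then have "s ! (?r + X g) = A i ! X g"
        using lt by (simp add: nth_append)
      then have "HashL i g = A i ! X g"
        using XT(2)[OF g] by (simp add: add.commute)
      then have "HashL i g \<in> set (A i)"
        using lt by simp
      then show False
        using HashL_notin_A[OF i(1)] by simp
    qed
    then have "(\<lambda>g. X g + T g) ` {1..l} \<subseteq> extra"
      by blast
    ultimately have "l \<le> k"
      using card_inj_on_le[of _ "{1..l}" extra] finite_extra card_extra by fastforce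
    then show False
      using k_less by simp
  qed
  then show ?thesis
    using that by (metis (no_types, lifting) atLeastAtMost_iff)
qed

text \<open>The occurrence is copied whole from the occurrence at \<open>w\<close>. If the two
  symbols at \<open>w + z\<close> lie before the phrase, both hop-numbers grow by 1; if
  \<open>w\<close> lies in the phrase, induction applies. Otherwise a further occurrence,
  \<open>d\<close> places before \<open>w\<close>, is needed.\<close>

lemma deep_copy:
  assumes i: "1 \<le> i" "i \<le> c" and es: "es \<noteq> []" and deep: "deep i z"
  shows "occ i x \<Longrightarrow> (\<And>t. t < length (A i) \<Longrightarrow> \<not> E (x + t)) \<Longrightarrow> Suc i < hp (x + z) \<or> Suc i < hp (x + z + 1)"
proof (induction x rule: less_induct)
  case (less x)
  let ?r = "length (A i)"
  have z: "z + 1 < ?r"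
    and deepD: "\<And>x. occ i x \<Longrightarrow> \<not> E (x + z) \<and> (i < hp (x + z) \<or> i < hp (x + z + 1))"
    using deep by (auto simp: deep_def)
  define m where "m = x + ?r - 1"
  have m: "m < length s" "m = x + (?r - 1)" "x + z + 1 \<le> m"
    using less.prems(1) z unfolding occ_def m_def by linarith+
  have no_end: "\<not> E m"
    using less.prems(2)[of "?r - 1"] z unfolding m(2) by linarith
  obtain b d where d: "0 < d" "d \<le> b" "b \<le> m" "E (b - 1)"
    and copy: "\<And>y. b \<le> y \<Longrightarrow> y \<le> m \<Longrightarrow> \<not> E y"
      "\<And>y. b \<le> y \<Longrightarrow> y \<le> m \<Longrightarrow> s ! y = s ! (y - d)"
      "\<And>y. b \<le> y \<Longrightarrow> y \<le> m \<Longrightarrow> hp y = hp (y - d) + (if y < b + d then 1 else 0)"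
    by (rule copy_phrase[OF lz m(1) no_end], rule that)
  \<comment> \<open>A phrase starting inside the occurrence would put the end \<open>b - 1\<close>
    there.\<close>
  have bx: "b \<le> x"
  proof (rule ccontr)
    assume "\<not> b \<le> x"
    then have "b - 1 = x + (b - 1 - x)" "b - 1 - x < ?r"
      using d(3) m(2) z by auto
    then show False
      using less.prems(2)[of "b - 1 - x"] d(4) by simp
  qed
  define w where "w = x - d"
  have w: "x = w + d" "w < x"
    using bx d(1,2) by (auto simp: w_def)
  have nth: "s ! (w + t) = A i ! t" if "t < ?r" for t
  proof -
    have "s ! (x + t) = s ! (x + t - d)"
      using that bx m(2) by (intro copy(2)) linarith+
    moreover have "x + t - d = w + t"
      using w(1) by simp
    ultimately show ?thesis
      using less.prems(1) that by (simp add: occ_def)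
  qed
  then have occ_w: "occ i w"
    using less.prems(1) w(2) by (simp add: occ_def)
  show ?case
  proof (cases "b \<le> w")
    case True
    then have "hp (x + z) = hp (w + z)" "hp (x + z + 1) = hp (w + z + 1)"
      using copy(3)[of "x + z"] copy(3)[of "x + z + 1"] m(3) w(1) by (simp_all add: ac_simps)
    moreover have "\<not> E (w + t)" if "t < ?r" for t
      using that True m(2) w(2) by (intro copy(1)) auto
    ultimately show ?thesis
      using less.IH[OF w(2) occ_w] by simp
  next
    case False
    show ?thesis
    proof (cases "w + z + 1 < b")
      case True
      then have "hp (x + z) = hp (w + z) + 1" "hp (x + z + 1) = hp (w + z + 1) + 1"
        using copy(3)[of "x + z"] copy(3)[of "x + z + 1"] m(3) w(1) bx by (simp_all add: ac_simps)
      then show ?thesis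
        using deepD[OF occ_w] by auto
    next
      case right: False
      \<comment> \<open>A start between the two source symbols would make \<open>w + z\<close> an
        end, against \<open>deep\<close>. So both source symbols lie in the phrase, although
        \<open>w\<close> does not.\<close>
      have "w + z + 1 \<noteq> b"
        using deepD[OF occ_w] d(4) by auto
      then have bz: "b \<le> w + z"
        using right by simp
      note aligned = ends_aligned_s[OF es i]
      have last: "A i ! (?r - 1) = last (A i)"
        using aligned(3) by (simp add: last_conv_nth)
      \<comment> \<open>A shorter period would repeat the last symbol of \<open>A i\<close> earlier
        in the same occurrence. With \<open>?r \<le> d\<close>, the two symbols at
        \<open>w + z\<close> lie in the first period, and one more step back by \<open>d\<close>
        leaves the phrase.\<close>
      have "?r \<le> d"
      proof (rule ccontr)
        assume "\<not> ?r \<le> d"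
        define t where "t = ?r - 1 - d"
        have t: "?r - 1 = t + d" "t < ?r - 1"
          using \<open>\<not> ?r \<le> d\<close> d(1) z unfolding t_def by linarith+
        have occ_x: "s ! (x + u) = A i ! u" if "u < ?r" for u
          using less.prems(1) that by (simp add: occ_def)
        have "s ! m = s ! (m - d)"
          using d(3) by (intro copy(2)) auto
        moreover have "m - d = x + t"
          using m(2) t(1) by simp
        ultimately have "A i ! (?r - 1) = A i ! t"
          using occ_x[of "?r - 1"] occ_x[of t] m(2) t by simp
        moreover have "A i ! t \<in> set (butlast (A i))"
          using t(2) by (metis length_butlast nth_butlast nth_mem)
        ultimately show False
          using aligned(2) last by simp
      qed
      then have hp_eq: "hp (x + z) = hp (w + z - d) + 1" "hp (x + z + 1) = hp (w + z + 1 - d) + 1"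
        using copy(3)[of "x + z"] copy(3)[of "x + z + 1"] copy(3)[of "w + z"] copy(3)[of "w + z + 1"]
          m(3) w bz z False by (simp_all add: ac_simps)
      \<comment> \<open>Only part of the occurrence at \<open>w\<close> lies in the phrase, so its
        shift by \<open>d\<close> is not a copy of all of it. But the end marker is copied, and
        \<open>ends_aligned\<close> restores a full occurrence ending at \<open>n\<close>, to which
        \<open>deep\<close> applies.\<close>
      define n where "n = w + (?r - 1) - d"
      have n: "w + (?r - 1) = n + d"
        using bz z d(2) unfolding n_def by simp
      have "s ! (n + d) = s ! (n + d - d)"
        using bz z m(2) w(2) n by (intro copy(2)) linarith+
      then have "s ! n = s ! (w + (?r - 1))"
        unfolding n by simp
      also have "\<dots> = last (A i)"
        using nth[of "?r - 1"] z last by simp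
      finally have "s ! n = last (A i)" .
      moreover have "n < length s"
        using m(1,2) w(2) n by simp
      ultimately obtain y u where y: "s = y @ A i @ u" "Suc n = length (y @ A i)"
        using aligned(1) unfolding ends_aligned_def by blast
      have "occ i (length y)"
        unfolding occ_def y(1) nth_append_length_plus by (simp add: nth_append)
      moreover have "length y + z = w + z - d" "length y + z + 1 = w + z + 1 - d"
        using y(2) n z bz d(2) by simp_all
      ultimately show ?thesis
        using deepD[of "length y"] hp_eq by auto
    qed
  qed
qed

text \<open>The new place is the old one in the copy of \<open>A i\<close> that
  \<open>untouched_copy\<close> provides: no phrase ends there in any occurrence of
  \<open>A (Suc i)\<close>, so \<open>deep_copy\<close> applies to it.\<close>

lemma deep_Suc:
  assumes i: "1 \<le> i" "i < c" and es: "es \<noteq> []" and deep: "deep i z"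
  shows "\<exists>z. deep (Suc i) z"
proof -
  let ?r = "length (A i)"
  obtain g where g: "1 \<le> g" "g \<le> l"
    "\<And>x t. occ i x \<Longrightarrow> s ! (x + ?r) = HashL i g \<Longrightarrow> t < ?r \<Longrightarrow> \<not> E (x + t)"
    by (rule untouched_copy[OF i], rule that)
  obtain u' v where "beta l i (A i) = u' @ A i @ [HashL i g] @ v"
    using beta_split[OF g(1,2)] by metis
  then obtain u where u: "A (Suc i) = u @ A i @ [HashL i g] @ v"
    using i(1) by (metis alpha_Suc append.assoc)
  have z: "z + 1 < ?r"
    using deep by (simp add: deep_def)
  have "deep (Suc i) (length u + z)"
    unfolding deep_def
  proof (intro conjI allI impI)
    show "length u + z + 1 < length (A (Suc i))"
      using z by (simp add: u)
    fix x assume x: "occ (Suc i) x"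
    let ?y = "x + length u"
    have y: "s ! (?y + t) = (A i @ [HashL i g] @ v) ! t" if "t \<le> ?r" for t
    proof -
      have "s ! (x + (length u + t)) = A (Suc i) ! (length u + t)"
        using x that unfolding occ_def by (simp add: u)
      then show ?thesis
        by (simp add: u add.assoc)
    qed
    have "occ i ?y"
      using x y unfolding occ_def by (simp add: u nth_append)
    moreover from this have no_end: "\<not> E (?y + t)" if "t < ?r" for t
      using g(3) y[of ?r] that by simp
    ultimately have "Suc i < hp (?y + z) \<or> Suc i < hp (?y + z + 1)"
      using deep_copy[OF i(1) _ es deep] i(2) by simp
    then show "\<not> E (x + (length u + z))"
      "Suc i < hp (x + (length u + z)) \<or> Suc i < hp (x + (length u + z) + 1)"
      using no_end[of z] z by (simp_all add: add.assoc)
  qed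
  then show ?thesis ..
qed

text \<open>\<open>s\<close> is \<open>A c\<close>, an occurrence of itself at 0, and a deep place
  on level \<open>c\<close> contradicts the bound on hop-numbers.\<close>

lemma charged_cover:
  assumes e: "e \<in> set es"
  shows "fst e \<in> charged ` extra \<or> snd e \<in> charged ` extra"
proof (rule ccontr)
  assume unc: "\<not> ?thesis"
  have es: "es \<noteq> []"
    using e by auto
  have "1 \<le> i \<Longrightarrow> i \<le> c \<Longrightarrow> \<exists>z. deep i z" for i
  proof (induction i rule: nat_induct_at_least)
    case base
    show ?case
      using deep_base[OF e] unc by simp
  next
    case (Suc i)
    then show ?case
      using deep_Suc[of i] es by auto
  qed
  then obtain z where "deep c z"
    using c_pos by blast
  moreover have "occ c 0"
    by (simp add: occ_def s_eq)
  ultimately have "z + 1 < length s" "c < hp z \<or> c < hp (z + 1)"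
    unfolding deep_def s_eq by (metis add_0, metis add_0)
  moreover have "hp x \<le> c" if "x < length s" for x
    using blz that by (simp add: blz_parsing_def)
  ultimately show False
    by (metis add_lessD1 not_le)
qed

end

section \<open>The equivalence of covers and parsings\<close>

theorem theorem2:
  fixes V :: "'v set" and E :: "'v set set"
    and vs :: "'v list" and es :: "('v \<times> 'v) list"
    and c k l :: nat
  assumes "simple_graph V E"
    and "graph_enum V E vs es"
    and "1 \<le> c"
    and "k \<le> card V"
    and "k < l"
  shows "(\<exists>C. vertex_cover V E C \<and> card C = k) \<longleftrightarrow>
         (\<exists>ps src. blz_parsing c (graph_string vs es c l) ps src \<and>
            length ps = 4 * card V + 6 * card E + k + l * (c - 1))"
proof -
  have vs: "distinct vs" "set vs = V" "length vs = card V"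
    using assms(2) distinct_card[of vs] by (auto simp: graph_enum_def)
  have E: "E = (\<lambda>e. {fst e, snd e}) ` set es" and es: "distinct es" "length es = card E"
    using assms(2) distinct_card[of "map (\<lambda>(p, q). {p, q}) es"]
    by (auto simp: graph_enum_def distinct_map case_prod_unfold)
  have ends: "fst e \<in> set vs \<and> snd e \<in> set vs \<and> fst e \<noteq> snd e" if "e \<in> set es" for e
  proof -
    have "{fst e, snd e} \<in> E"
      using that unfolding E by blast
    then have "{fst e, snd e} \<subseteq> V" "card {fst e, snd e} = 2"
      using assms(1) unfolding simple_graph_def by blast+
    then show ?thesis
      unfolding vs(2) by (cases "fst e = snd e") simp_all
  qed
  have cover: "vertex_cover V E C \<longleftrightarrow> C \<subseteq> V \<and> (\<forall>e\<in>set es. fst e \<in> C \<or> snd e \<in> C)" for C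
    unfolding vertex_cover_def E by auto
  show ?thesis
  proof (intro iffI)
    assume "\<exists>C. vertex_cover V E C \<and> card C = k"
    then obtain C where "C \<subseteq> V" "\<forall>e\<in>set es. fst e \<in> C \<or> snd e \<in> C" "card C = k"
      unfolding cover by blast
    then show "\<exists>ps src. blz_parsing c (graph_string vs es c l) ps src \<and>
        length ps = 4 * card V + 6 * card E + k + l * (c - 1)"
      using vertex_cover_imp_blz_parsing[of es vs C c l] ends vs(1) assms(3)
      unfolding vs(2,3) es(2) by blast
  next
    assume "\<exists>ps src. blz_parsing c (graph_string vs es c l) ps src \<and>
        length ps = 4 * card V + 6 * card E + k + l * (c - 1)"
    then obtain ps src where blz: "blz_parsing c (graph_string vs es c l) ps src"
      and len: "length ps = 4 * length vs + 6 * length es + k + l * (c - 1)"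
      unfolding vs(3) es(2) by blast
    interpret gadget vs es c l
      by unfold_locales (use vs(1) es(1) ends assms(3,5) in auto)
    interpret gadget_parsing vs es c l ps src k
      by unfold_locales (use blz len assms(5) in \<open>simp_all add: s_def\<close>)
    \<comment> \<open>At symbols without a vertex \<open>charged\<close> is
      \<open>undefined\<close>; the intersection keeps only vertices.\<close>
    define C where "C = charged ` extra \<inter> V"
    have fin: "finite V"
      using assms(1) by (simp add: simple_graph_def)
    have "card C \<le> card (charged ` extra)"
      unfolding C_def using finite_extra by (intro card_mono) auto
    also have "\<dots> \<le> k"
      using card_image_le[OF finite_extra] card_extra by metis
    \<comment> \<open>There may be fewer than \<open>k\<close> charged vertices;
      \<open>k \<le> card V\<close> leaves room to enlarge \<open>C\<close> to exactly
      \<open>k\<close>.\<close>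
    finally obtain D where D: "C \<subseteq> D" "D \<subseteq> V" "card D = k"
      using exists_subset_between[of C k V] assms(4) fin unfolding C_def by blast
    have "\<forall>e\<in>set es. fst e \<in> D \<or> snd e \<in> D"
    proof
      fix e assume e: "e \<in> set es"
      then have "fst e \<in> V" "snd e \<in> V"
        using ends vs(2) by auto
      then show "fst e \<in> D \<or> snd e \<in> D"
        using charged_cover[OF e] D(1) by (auto simp: C_def)
    qed
    then show "\<exists>C. vertex_cover V E C \<and> card C = k"
      unfolding cover using D(2,3) by blast
  qed
qed

end
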